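(* Let $\Omega$ be a metrizable separable space, $c$ a Prokhorov capacity on $\mathcal{L}$, and $\rho$ a convex risk measure on $L^1(c)$ represented as $\rho(X)=\sup_{Q\in\mathcal{Q}}(E_Q(-X)-\alpha(Q))$ for all $X\in L^1(c)$, where $\alpha(Q)=\sup_{Y\in L^1(c)}(E_Q(-Y)-\rho(Y))$ and $\mathcal{Q}$ is a set of Borel probability measures belonging to $L^1(c)^*$ that is relatively compact for the weak* topology $\sigma(L^1(c)^*,L^1(c))$. Let $\overline{\mathcal{Q}}$ be the weak* closure of $\mathcal{Q}$. Then $\overline{\mathcal{Q}}$ is metrizable compact both for the weak* topology and for the weak topology, and for every $X\in L^1(c)$ there is $Q_X\in\overline{\mathcal{Q}}$ with $\rho(X)=E_{Q_X}(-X)-\alpha(Q_X)$.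
   Context: $\Omega$ is a metrizable separable space with Borel $\sigma$-algebra; $\mathcal{L}\subset\mathcal{C}_b(\Omega)$ is a linear subspace which is a vector lattice, contains the constants and generates the topology. A capacity on $\mathcal{L}$ is a seminorm $c$ with $c(f)\le c(g)$ whenever $|f|\le|g|$ and $\inf_n c(f_n)=0$ for $f_n\in\mathcal{L}$ decreasing to $0$; it is extended to all functions by $c(f)=\sup\{c(\varphi):\varphi\in\mathcal{L},0\le\varphi\le f\}$ for $f\ge0$ l.s.c. and $c(g)=\inf\{c(f):f\text{ l.s.c.},f\ge|g|\}$. $L^1(c)$ is the Banach space obtained as the quotient by $c$-null elements of the $c$-closure of $\mathcal{L}$ in $\{g:c(g)<\infty\}$. $c$ is Prokhorov if for each $\varepsilon>0$ there is a compact $K$ with $c(f)\le\varepsilon$ whenever $f\in\mathcal{L}$, $|f|\le1_{\Omega\setminus K}$. Order on $L^1(c)$: $X\ge0$ iff some $f_n\in\mathcal{L}$, $f_n\ge0$, satisfy $c(g-f_n)\to0$ for every representative $g$ of $X$. A convex risk measure is monotone, convex and translation invariant ($\rho(X+a)=\rho(X)-a$). A Borel probability measure $Q$ belongs to $L^1(c)^*$ if $f\mapsto\int f\,dQ$ defines a continuous linear form on $L^1(c)$, with value $E_Q(X)$ at $X$. The weak topology on finite nonnegative Borel measures is the coarsest making $\mu\mapsto\int f\,d\mu$ continuous for all $f\in\mathcal{C}_b(\Omega)$. *)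

theory Defs
  imports "HOL-Probability.Probability"
begin

definition borel_of :: "'a topology \<Rightarrow> 'a measure" where
  "borel_of X = sigma (topspace X) {U. openin X U}"

definition Cb :: "'a topology \<Rightarrow> ('a \<Rightarrow> real) set" where
  "Cb X = {f. continuous_map X euclideanreal f \<and> bounded (f ` topspace X)}"

definition admissible_lattice :: "'a topology \<Rightarrow> ('a \<Rightarrow> real) set \<Rightarrow> bool" where
  "admissible_lattice X L \<longleftrightarrow>
     L \<subseteq> Cb X \<and>
     (\<forall>f\<in>L. \<forall>g\<in>L. (\<lambda>x. f x + g x) \<in> L) \<and>
     (\<forall>f\<in>L. \<forall>a::real. (\<lambda>x. a * f x) \<in> L) \<and>
     (\<forall>f\<in>L. \<forall>g\<in>L. (\<lambda>x. max (f x) (g x)) \<in> L) \<and>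
     (\<forall>a::real. (\<lambda>x. a) \<in> L) \<and>
     X = topology_generated_by {f -` U | f U. f \<in> L \<and> open U}"

definition capacity :: "('a \<Rightarrow> real) set \<Rightarrow> (('a \<Rightarrow> real) \<Rightarrow> real) \<Rightarrow> bool" where
  "capacity L c \<longleftrightarrow>
     (\<forall>f\<in>L. \<forall>g\<in>L. c (\<lambda>x. f x + g x) \<le> c f + c g) \<and>
     (\<forall>f\<in>L. \<forall>a::real. c (\<lambda>x. a * f x) = \<bar>a\<bar> * c f) \<and>
     (\<forall>f\<in>L. \<forall>g\<in>L. (\<forall>x. \<bar>f x\<bar> \<le> \<bar>g x\<bar>) \<longrightarrow> c f \<le> c g) \<and>
     (\<forall>fs. (\<forall>n. fs n \<in> L) \<and> (\<forall>x. decseq (\<lambda>n. fs n x) \<and> (\<lambda>n. fs n x) \<longlonglongrightarrow> 0)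
            \<longrightarrow> (INF n. c (fs n)) = 0)"

definition lsc_on :: "'a topology \<Rightarrow> ('a \<Rightarrow> ereal) \<Rightarrow> bool" where
  "lsc_on X f \<longleftrightarrow> (\<forall>t. openin X {x \<in> topspace X. t < f x})"

definition cap_lsc :: "('a \<Rightarrow> real) set \<Rightarrow> (('a \<Rightarrow> real) \<Rightarrow> real) \<Rightarrow> ('a \<Rightarrow> ereal) \<Rightarrow> ereal" where
  "cap_lsc L c f = (SUP \<phi> \<in> {\<phi> \<in> L. \<forall>x. 0 \<le> \<phi> x \<and> ereal (\<phi> x) \<le> f x}. ereal (c \<phi>))"

definition cap :: "'a topology \<Rightarrow> ('a \<Rightarrow> real) set \<Rightarrow> (('a \<Rightarrow> real) \<Rightarrow> real) \<Rightarrow> ('a \<Rightarrow> real) \<Rightarrow> ereal" where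
  "cap X L c g = (INF f \<in> {f. lsc_on X f \<and> (\<forall>x. ereal \<bar>g x\<bar> \<le> f x)}. cap_lsc L c f)"

text \<open>Representatives of elements of L^1(c): the c-closure of L inside {g. c(g) < \<infinity>}.
  L^1(c) is the quotient of this set by c-null functions.\<close>
definition L1set :: "'a topology \<Rightarrow> ('a \<Rightarrow> real) set \<Rightarrow> (('a \<Rightarrow> real) \<Rightarrow> real) \<Rightarrow> ('a \<Rightarrow> real) set" where
  "L1set X L c = {g. cap X L c g < \<infinity> \<and>
                     (\<forall>e>0. \<exists>\<phi>\<in>L. cap X L c (\<lambda>x. g x - \<phi> x) < ereal e)}"

definition L1_nonneg :: "'a topology \<Rightarrow> ('a \<Rightarrow> real) set \<Rightarrow> (('a \<Rightarrow> real) \<Rightarrow> real) \<Rightarrow> ('a \<Rightarrow> real) \<Rightarrow> bool" where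
  "L1_nonneg X L c g \<longleftrightarrow>
     (\<exists>fs. (\<forall>n. fs n \<in> L \<and> (\<forall>x. 0 \<le> fs n x)) \<and>
           (\<forall>h\<in>L1set X L c. cap X L c (\<lambda>x. g x - h x) = 0 \<longrightarrow>
               (\<lambda>n. cap X L c (\<lambda>x. h x - fs n x)) \<longlonglongrightarrow> 0))"

definition convex_risk_measure ::
  "'a topology \<Rightarrow> ('a \<Rightarrow> real) set \<Rightarrow> (('a \<Rightarrow> real) \<Rightarrow> real) \<Rightarrow> (('a \<Rightarrow> real) \<Rightarrow> real) \<Rightarrow> bool" where
  "convex_risk_measure X L c \<rho> \<longleftrightarrow>
     (\<forall>g\<in>L1set X L c. \<forall>h\<in>L1set X L c. cap X L c (\<lambda>x. g x - h x) = 0 \<longrightarrow> \<rho> g = \<rho> h) \<and>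
     (\<forall>g\<in>L1set X L c. \<forall>h\<in>L1set X L c. L1_nonneg X L c (\<lambda>x. h x - g x) \<longrightarrow> \<rho> h \<le> \<rho> g) \<and>
     (\<forall>g\<in>L1set X L c. \<forall>h\<in>L1set X L c. \<forall>t::real. 0 \<le> t \<and> t \<le> 1 \<longrightarrow>
        \<rho> (\<lambda>x. t * g x + (1 - t) * h x) \<le> t * \<rho> g + (1 - t) * \<rho> h) \<and>
     (\<forall>g\<in>L1set X L c. \<forall>a::real. \<rho> (\<lambda>x. g x + a) = \<rho> g - a)"

definition borel_prob :: "'a topology \<Rightarrow> 'a measure set" where
  "borel_prob X = {Q. prob_space Q \<and> sets Q = sets (borel_of X) \<and> space Q = topspace X}"

text \<open>Borel probability measures belonging to L^1(c)^*: integration against Q is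
  c-continuous on L, hence extends to a continuous linear form on L^1(c).\<close>
definition dual_prob :: "'a topology \<Rightarrow> ('a \<Rightarrow> real) set \<Rightarrow> (('a \<Rightarrow> real) \<Rightarrow> real) \<Rightarrow> 'a measure set" where
  "dual_prob X L c = {Q \<in> borel_prob X. \<exists>C::real. \<forall>f\<in>L. \<bar>integral\<^sup>L Q f\<bar> \<le> C * c f}"

text \<open>The value E_Q(X) of the continuous extension at (a representative g of) X.\<close>
definition EQ :: "'a topology \<Rightarrow> ('a \<Rightarrow> real) set \<Rightarrow> (('a \<Rightarrow> real) \<Rightarrow> real) \<Rightarrow> 'a measure \<Rightarrow> ('a \<Rightarrow> real) \<Rightarrow> real" where
  "EQ X L c Q g = (THE v. \<forall>e>0. \<exists>d>0. \<forall>\<phi>\<in>L.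
       cap X L c (\<lambda>x. g x - \<phi> x) < ereal d \<longrightarrow> \<bar>integral\<^sup>L Q \<phi> - v\<bar> < e)"

definition penalty :: "'a topology \<Rightarrow> ('a \<Rightarrow> real) set \<Rightarrow> (('a \<Rightarrow> real) \<Rightarrow> real) \<Rightarrow> (('a \<Rightarrow> real) \<Rightarrow> real) \<Rightarrow> 'a measure \<Rightarrow> ereal" where
  "penalty X L c \<rho> Q = (SUP Y \<in> L1set X L c. ereal (EQ X L c Q (\<lambda>x. - Y x) - \<rho> Y))"

definition L1_dual :: "'a topology \<Rightarrow> ('a \<Rightarrow> real) set \<Rightarrow> (('a \<Rightarrow> real) \<Rightarrow> real) \<Rightarrow> (('a \<Rightarrow> real) \<Rightarrow> real) set" where
  "L1_dual X L c = {l \<in> extensional (L1set X L c).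
      (\<forall>g\<in>L1set X L c. \<forall>h\<in>L1set X L c. l (\<lambda>x. g x + h x) = l g + l h) \<and>
      (\<forall>g\<in>L1set X L c. \<forall>a::real. l (\<lambda>x. a * g x) = a * l g) \<and>
      (\<exists>C::real. \<forall>g\<in>L1set X L c. ereal \<bar>l g\<bar> \<le> ereal C * cap X L c g)}"

definition weak_star :: "'a topology \<Rightarrow> ('a \<Rightarrow> real) set \<Rightarrow> (('a \<Rightarrow> real) \<Rightarrow> real) \<Rightarrow> (('a \<Rightarrow> real) \<Rightarrow> real) topology" where
  "weak_star X L c = subtopology (product_topology (\<lambda>_. euclideanreal) (L1set X L c)) (L1_dual X L c)"

definition EQform :: "'a topology \<Rightarrow> ('a \<Rightarrow> real) set \<Rightarrow> (('a \<Rightarrow> real) \<Rightarrow> real) \<Rightarrow> 'a measure \<Rightarrow> (('a \<Rightarrow> real) \<Rightarrow> real)" where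
  "EQform X L c Q = (\<lambda>g \<in> L1set X L c. EQ X L c Q g)"

definition borel_finite :: "'a topology \<Rightarrow> 'a measure set" where
  "borel_finite X = {\<mu>. finite_measure \<mu> \<and> sets \<mu> = sets (borel_of X) \<and> space \<mu> = topspace X}"

definition weak_topology :: "'a topology \<Rightarrow> 'a measure topology" where
  "weak_topology X = pullback_topology (borel_finite X)
      (\<lambda>\<mu>. \<lambda>f \<in> Cb X. integral\<^sup>L \<mu> f) (product_topology (\<lambda>_. euclideanreal) (Cb X))"

definition prokhorov :: "'a topology \<Rightarrow> ('a \<Rightarrow> real) set \<Rightarrow> (('a \<Rightarrow> real) \<Rightarrow> real) \<Rightarrow> bool" where
  "prokhorov X L c \<longleftrightarrow> (\<forall>e>0. \<exists>K. compactin X K \<and>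
      (\<forall>f\<in>L. (\<forall>x. \<bar>f x\<bar> \<le> indicator (topspace X - K) x) \<longrightarrow> c f \<le> e))"

end

theory Submission
  imports Defs
begin

text \<open>The space \<open>X\<close> is second countable and \<open>L\<close> is a lattice generating its topology, so every
  nonnegative lower semicontinuous function is the pointwise limit of an increasing sequence of
  elements of \<open>L\<close>. This makes the extended capacity subadditive, so that \<open>E_Q\<close> is a bounded linear
  form on \<open>L^1(c)\<close>. An element of the weak* closure is positive and normalised, and continuity of \<open>c\<close>
  along sequences decreasing to \<open>0\<close> makes it a Daniell integral on \<open>L\<close>, hence a probability measure.
  The same approximation shows that \<open>Q \<mapsto> \<integral> f dQ\<close> and \<open>Q \<mapsto> \<integral> (- f) dQ\<close> are weak* lower
  semicontinuous for bounded continuous \<open>f\<close>, so the weak topology is coarser than the weak*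
  topology on the closure; countably many elements of \<open>L\<close> separate measures, which makes both
  compact topologies metrizable. The supremum is attained since \<open>Q \<mapsto> E_Q(- X) - \<alpha>(Q)\<close> is weak*
  upper semicontinuous.\<close>

section \<open>Approximation by elements of the lattice\<close>

text \<open>Both \<open>c\<close> and the forms in the closure are continuous only along sequences,
  so an upward directed family of minorants from \<open>L\<close> would give no control. A countable
  base supplies a countable subfamily, and running maxima turn it into a sequence.
  \<open>l_le_om\<close> and \<open>C_lsc_add\<close> then use one device: if \<open>u n\<close>
  increases to a limit that dominates a function \<phi> of \<open>L\<close>, the positive part of
  \<phi> - \<open>u n\<close> decreases to 0, hence has a small value.

  A weak* limit of probability measures is at first only a linear form. Its sequential continuity is
  not taken from the approximating measures, whose bounds against \<open>c\<close> may differ, but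
  from the bound by a multiple of \<open>c\<close> that every member of the dual carries by
  definition.

  The closure is thus seen twice, as a set of forms and as a set of measures, and the bijection
  between the two carries compactness from the weak* to the weak topology.\<close>

lemma separable_metrizable_imp_second_countable:
  assumes "metrizable_space X" "separable_space X"
  shows "second_countable X"
proof -
  obtain M d where Md: "Metric_space M d" and X: "X = Metric_space.mtopology M d"
    using assms(1) metrizable_space_def by blast
  interpret Metric_space M d by (fact Md)
  obtain C where C: "countable C" "C \<subseteq> M" "X closure_of C = M"
    using assms(2) by (auto simp: separable_space_def X)
  define B where "B = (\<lambda>(x, n). mball x (1 / real (Suc n))) ` (C \<times> (UNIV::nat set))"
  have "countable B"
    unfolding B_def using C(1) by blast
  moreover have "\<forall>V\<in>B. openin X V"
    by (auto simp: B_def X)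
  moreover have "\<exists>V\<in>B. x \<in> V \<and> V \<subseteq> U" if U: "openin X U" "x \<in> U" for U x
  proof -
    obtain r where r: "r > 0" "mball x r \<subseteq> U" and xM: "x \<in> M"
      using U unfolding X openin_mtopology by blast
    obtain n where n: "1 / real (Suc n) < r / 2"
      using nat_approx_posE[of "r / 2"] r by auto
    have "x \<in> X closure_of C"
      using C xM by simp
    then obtain y where y: "y \<in> C" "y \<in> mball x (1 / real (Suc n))"
      unfolding in_closure_of X
      by (metis Metric_space.centre_in_mball_iff Metric_space_axioms openin_mball zero_less_divide_1_iff of_nat_0_less_iff zero_less_Suc xM)
    have "mball y (1 / real (Suc n)) \<subseteq> mball x r"
    proof
      fix z assume z: "z \<in> mball y (1 / real (Suc n))"
      then have "d x z \<le> d x y + d y z"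
        using y xM triangle by auto
      then show "z \<in> mball x r"
        using z y n xM by auto
    qed
    moreover have "x \<in> mball y (1 / real (Suc n))"
      using y by (auto simp: commute)
    ultimately show ?thesis
      using y(1) r(2) unfolding B_def by blast
  qed
  ultimately show ?thesis
    unfolding second_countable_def by blast
qed

text \<open>The functions \<open>e d\<close> embed T into a countable product of real lines: the
  joint map is injective by \<open>sep\<close>, and closed because it goes from a compact space to a
  Hausdorff one.\<close>

lemma compact_metrizable_if_countably_separated:
  fixes e :: "'b \<Rightarrow> 'a \<Rightarrow> real"
  assumes T: "compact_space T" and D: "countable D"
    and cont: "\<And>d. d \<in> D \<Longrightarrow> continuous_map T euclideanreal (e d)"
    and sep: "\<And>x y. x \<in> topspace T \<Longrightarrow> y \<in> topspace T \<Longrightarrow> (\<And>d. d \<in> D \<Longrightarrow> e d x = e d y) \<Longrightarrow> x = y"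
  shows "metrizable_space T"
proof -
  let ?P = "product_topology (\<lambda>_. euclideanreal) D"
  let ?F = "\<lambda>x. \<lambda>d\<in>D. e d x"
  have P: "metrizable_space ?P"
    by (simp add: metrizable_space_product_topology metrizable_space_euclidean D countable_subset)
  have c: "continuous_map T ?P ?F"
    using cont by (auto simp: continuous_map_componentwise)
  have "closed_map T ?P ?F"
    using T P c by (simp add: continuous_imp_closed_map_gen Hausdorff_imp_kc_space metrizable_imp_Hausdorff_space)
  moreover have "inj_on ?F (topspace T)"
    by (rule inj_onI) (metis restrict_apply' sep)
  ultimately have "embedding_map T ?P ?F"
    using c injective_closed_imp_embedding_map by blast
  then show ?thesis
    using embedding_map_imp_homeomorphic_space homeomorphic_metrizable_space metrizable_space_subtopology P by blast
qed

locale lattice_space =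
  fixes X :: "'a topology" and L :: "('a \<Rightarrow> real) set"
  assumes topX: "topspace X = UNIV"
    and second_countable: "second_countable X"
    and adm: "admissible_lattice X L"
begin

lemma L_add: "f \<in> L \<Longrightarrow> g \<in> L \<Longrightarrow> (\<lambda>x. f x + g x) \<in> L"
  and L_scale: "f \<in> L \<Longrightarrow> (\<lambda>x. a * f x) \<in> L"
  and L_max: "f \<in> L \<Longrightarrow> g \<in> L \<Longrightarrow> (\<lambda>x. max (f x) (g x)) \<in> L"
  and L_const: "(\<lambda>x. a) \<in> L"
  and L_Cb: "f \<in> L \<Longrightarrow> f \<in> Cb X"
  and X_generated: "X = topology_generated_by {f -` U | f U. f \<in> L \<and> open U}"
  using adm unfolding admissible_lattice_def by blast+

lemma L_uminus: "f \<in> L \<Longrightarrow> (\<lambda>x. - f x) \<in> L"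
  using L_scale[of f "-1"] by simp

lemma L_diff: "f \<in> L \<Longrightarrow> g \<in> L \<Longrightarrow> (\<lambda>x. f x - g x) \<in> L"
  using L_add[of f "\<lambda>x. - g x"] L_uminus[of g] by simp

lemma L_min: "f \<in> L \<Longrightarrow> g \<in> L \<Longrightarrow> (\<lambda>x. min (f x) (g x)) \<in> L"
  using L_uminus[OF L_max[OF L_uminus[of f] L_uminus[of g]]]
  by (simp add: minus_max_eq_min)

lemma L_abs:
  assumes "f \<in> L"
  shows "(\<lambda>x. \<bar>f x\<bar>) \<in> L"
proof -
  have "(\<lambda>x. \<bar>f x\<bar>) = (\<lambda>x. max (f x) (- f x))"
    by auto
  then show ?thesis
    using L_max[OF assms L_uminus[OF assms]] by simp
qed

lemma L_sum: "(\<And>i. i \<in> I \<Longrightarrow> f i \<in> L) \<Longrightarrow> (\<lambda>x. \<Sum>i\<in>I. f i x) \<in> L"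
  by (induction I rule: infinite_finite_induct) (auto intro: L_const L_add)

lemmas L_intros = L_add L_scale L_max L_const L_uminus L_diff L_min L_abs L_sum

lemma L_continuous: "f \<in> L \<Longrightarrow> continuous_map X euclideanreal f"
  using L_Cb unfolding Cb_def by blast

lemma L_bounded: "f \<in> L \<Longrightarrow> \<exists>B. \<forall>x. \<bar>f x\<bar> \<le> B"
  using L_Cb unfolding Cb_def topX bounded_iff by auto

lemma openin_preimage: "continuous_map X euclideanreal f \<Longrightarrow> open U \<Longrightarrow> openin X {x. f x \<in> U}"
  using openin_continuous_map_preimage[of X euclideanreal f U] topX by simp

text \<open>Preimages under members of \<open>L\<close> form a subbase, so induction on the
  generation of U reduces the claim to a single preimage. Intersections are handled by minima; in a
  union one member containing x suffices.\<close>

lemma bump: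
  assumes "openin X U" "x \<in> U"
  shows "\<exists>b\<in>L. b x = 1 \<and> (\<forall>y. 0 \<le> b y \<and> b y \<le> 1) \<and> (\<forall>y. y \<notin> U \<longrightarrow> b y = 0)"
proof -
  have "generate_topology_on {f -` U | f U. f \<in> L \<and> open (U::real set)} U"
    using assms(1) by (simp add: X_generated[symmetric] flip: openin_topology_generated_by_iff)
  then show ?thesis
    using assms(2)
  proof (induction rule: generate_topology_on.induct)
    case (Int a b)
    then obtain f g where "f \<in> L" "f x = 1" "\<forall>y. 0 \<le> f y \<and> f y \<le> 1" "\<forall>y. y \<notin> a \<longrightarrow> f y = 0"
      and "g \<in> L" "g x = 1" "\<forall>y. 0 \<le> g y \<and> g y \<le> 1" "\<forall>y. y \<notin> b \<longrightarrow> g y = 0"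
      by blast
    then show ?case
      by (intro bexI[of _ "\<lambda>y. min (f y) (g y)"] L_min) (auto intro: min.coboundedI1)
  next
    case (UN K)
    then obtain k where k: "k \<in> K" "x \<in> k"
      by blast
    then obtain b where "b \<in> L" "b x = 1" "\<forall>y. 0 \<le> b y \<and> b y \<le> 1" "\<forall>y. y \<notin> k \<longrightarrow> b y = 0"
      using UN.IH by blast
    then show ?case
      using k by (intro bexI[of _ b]) auto
  next
    case (Basis s)
    then obtain f V where f: "s = f -` V" "f \<in> L" "open V"
      by auto
    then obtain e where e: "e > 0" "ball (f x) e \<subseteq> V"
      using Basis open_contains_ball by (metis vimageE)
    \<comment> \<open>A tent over the value \<open>f x\<close>, of height 1 and vanishing as soon as
      \<open>f y\<close> is at distance at least e from it, which is the case off s.\<close>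
    define b where "b = (\<lambda>y. max 0 (1 - (1 / e) * \<bar>f y - f x\<bar>))"
    have "b \<in> L"
      unfolding b_def by (intro L_intros f)
    moreover have "b y = 0" if "y \<notin> s" for y
    proof -
      have "f y \<notin> ball (f x) e"
        using that f e by blast
      then show ?thesis
        using e unfolding b_def by (simp add: dist_real_def field_simps abs_minus_commute)
    qed
    ultimately show ?case
      using e by (intro bexI[of _ b]) (auto simp: b_def)
  qed auto
qed

text \<open>Scaled bumps show that f is the supremum of its minorants in \<open>L\<close>. Countably
  many suffice: for each base set V and rational q such that some minorant exceeds q on V, one such
  minorant is selected.\<close>

lemma approx_lsc:
  assumes f: "lsc_on X f" "\<And>x. 0 \<le> f x"
  obtains u where "\<And>n. u n \<in> L" "\<And>n x. 0 \<le> u n x" "\<And>n x. ereal (u n x) \<le> f x"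
    "\<And>x. incseq (\<lambda>n. u n x)" "\<And>x. (SUP n. ereal (u n x)) = f x"
proof -
  obtain B where B: "countable B"
    and Bb: "\<forall>U x. openin X U \<and> x \<in> U \<longrightarrow> (\<exists>V\<in>B. x \<in> V \<and> V \<subseteq> U)"
    using second_countable unfolding second_countable_def by (elim exE conjE)
  define F where "F = {\<phi>\<in>L. \<forall>x. 0 \<le> \<phi> x \<and> ereal (\<phi> x) \<le> f x}"
  define good where "good = (\<lambda>(V, q::rat) \<phi>. \<phi> \<in> F \<and> (\<forall>x\<in>V. real_of_rat q < \<phi> x))"
  \<comment> \<open>The zero function keeps D nonempty, as its enumeration requires, and is the
    minorant that serves negative levels.\<close>
  define D where "D = insert (\<lambda>x. 0) ((\<lambda>p. SOME \<phi>. good p \<phi>) ` {p \<in> B \<times> UNIV. \<exists>\<phi>. good p \<phi>})"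
  have "countable D"
    unfolding D_def using B by (intro countable_insert countable_image) auto
  have "(\<lambda>x. 0) \<in> F"
    using f L_const by (auto simp: F_def zero_ereal_def[symmetric])
  then have DF: "D \<subseteq> F"
    unfolding D_def by (auto dest!: someI_ex simp: good_def)
  have D_approx: "\<exists>d\<in>D. q < ereal (d x)" if q: "q < f x" for q x
  proof (cases "q < 0")
    case True
    then show ?thesis
      by (intro bexI[of _ "\<lambda>x. 0"]) (auto simp: D_def zero_ereal_def[symmetric])
  next
    case False
    \<comment> \<open>Levels q < s < t < r < \<open>f x\<close>: r is the height of the bump, the
      rational t is the level recorded by the selection, and the real s separates the extended real
      q from t.\<close>
    obtain r :: real where r: "q < ereal r" "ereal r < f x"
      using ereal_dense2[OF q] by blast
    obtain s where s: "q < ereal s" "s < r"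
      using ereal_dense2[OF r(1)] by auto
    obtain t :: rat where t: "s < real_of_rat t" "real_of_rat t < r"
      using of_rat_dense s by blast
    have "0 \<le> s"
      using False s by (metis ereal_less_eq(5) le_less_linear less_trans less_le)
    let ?U = "{x. ereal r < f x}"
    have "openin X ?U"
      using f topX unfolding lsc_on_def by simp
    then obtain b where b: "b \<in> L" "b x = 1" "\<forall>y. 0 \<le> b y \<and> b y \<le> 1" "\<forall>y. y \<notin> ?U \<longrightarrow> b y = 0"
      using bump[of ?U x] r by blast
    define \<phi> where "\<phi> = (\<lambda>y. r * b y)"
    have \<phi>F: "\<phi> \<in> F"
    proof -
      have "ereal (r * b y) \<le> f y" for y
      proof (cases "y \<in> ?U")
        case True
        have "r * b y \<le> r"
          using b(3) \<open>0 \<le> s\<close> s by (simp add: mult_left_le)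
        then show ?thesis
          using True by (meson ereal_less_eq(3) less_imp_le mem_Collect_eq order_trans)
      qed (use b f in \<open>simp add: zero_ereal_def[symmetric]\<close>)
      moreover have "0 \<le> r * b y" for y
        using b(3) \<open>0 \<le> s\<close> s by simp
      ultimately show ?thesis
        using b by (auto simp: F_def \<phi>_def intro: L_scale)
    qed
    have "openin X {y. \<phi> y \<in> {real_of_rat t<..}}"
      using \<phi>F by (intro openin_preimage L_continuous) (auto simp: F_def)
    moreover have "x \<in> {y. \<phi> y \<in> {real_of_rat t<..}}"
      using b t by (simp add: \<phi>_def)
    ultimately obtain V where V: "V \<in> B" "x \<in> V" "V \<subseteq> {y. \<phi> y \<in> {real_of_rat t<..}}"
      using Bb by meson
    then have "good (V, t) \<phi>"
      using \<phi>F by (auto simp: good_def)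
    then have g: "good (V, t) (SOME \<phi>. good (V, t) \<phi>)"
      by (rule someI[of "good (V, t)" \<phi>])
    have "(SOME \<phi>. good (V, t) \<phi>) \<in> D"
      using V(1) \<open>good (V, t) \<phi>\<close> unfolding D_def by blast
    moreover have "s < (SOME \<phi>. good (V, t) \<phi>) x"
      using g V(2) t(1) unfolding good_def by (auto intro: less_trans)
    ultimately show ?thesis
      using s(1) by (meson ereal_less_eq(3) less_imp_le order.strict_trans2)
  qed
  define d where "d = from_nat_into D"
  have dD: "d n \<in> D" for n
    unfolding d_def by (rule from_nat_into) (simp add: D_def)
  have dR: "range d = D"
    unfolding d_def using \<open>countable D\<close> by (intro range_from_nat_into) (auto simp: D_def)
  \<comment> \<open>Running maxima are increasing, stay below f, and dominate every enumerated
    minorant.\<close>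
  define u where "u = rec_nat (d 0) (\<lambda>n v x. max (v x) (d (Suc n) x))"
  have u0: "u 0 = d 0" and uS: "u (Suc n) = (\<lambda>x. max (u n x) (d (Suc n) x))" for n
    by (auto simp: u_def)
  have uF: "u n \<in> F" for n
  proof (induction n)
    case 0
    then show ?case using dD DF u0 by auto
  next
    case (Suc n)
    then show ?case
      using dD[of "Suc n"] DF by (auto simp: uS F_def max_def intro: L_max[unfolded max_def])
  qed
  have inc: "incseq (\<lambda>n. u n x)" for x
    by (rule incseq_SucI) (simp add: uS)
  have ge: "d n x \<le> u n x" for n x
    by (cases n) (auto simp: u0 uS)
  show thesis
  proof (rule that[of u])
    fix x
    show "(SUP n. ereal (u n x)) = f x"
    proof (rule antisym)
      show "(SUP n. ereal (u n x)) \<le> f x"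
        using uF by (auto intro!: SUP_least simp: F_def)
      show "f x \<le> (SUP n. ereal (u n x))"
      proof (rule dense_le)
        fix q assume "q < f x"
        then obtain n where "q < ereal (d n x)"
          using D_approx dR by (metis imageE)
        also have "\<dots> \<le> ereal (u n x)"
          using ge by simp
        also have "\<dots> \<le> (SUP n. ereal (u n x))"
          by (rule SUP_upper) simp
        finally show "q \<le> (SUP n. ereal (u n x))" by simp
      qed
    qed
  qed (use uF inc in \<open>auto simp: F_def\<close>)
qed

end

section \<open>The Daniell--Stone theorem\<close>

context lattice_space
begin

lemma approx_open:
  assumes U: "openin X U"
  shows "\<exists>h. (\<forall>n. h n \<in> L \<and> (\<forall>x. 0 \<le> h n x \<and> h n x \<le> indicator U x)) \<and>
    (\<forall>x. incseq (\<lambda>n. h n x) \<and> (\<lambda>n. h n x) \<longlonglongrightarrow> indicator U x)"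
proof -
  let ?I = "\<lambda>x. ereal (indicator U x)"
  have "lsc_on X ?I"
    unfolding lsc_on_def
  proof
    fix t :: ereal
    have "{x \<in> topspace X. t < ?I x} = UNIV \<or> {x \<in> topspace X. t < ?I x} = U
        \<or> {x \<in> topspace X. t < ?I x} = {}"
      by (cases t) (auto simp: topX indicator_def split: if_splits)
    then show "openin X {x \<in> topspace X. t < ?I x}"
      using U topX openin_topspace[of X] by auto
  qed
  then obtain h where h: "\<And>n. h n \<in> L" "\<And>n x. 0 \<le> h n x" "\<And>n x. ereal (h n x) \<le> ?I x"
    "\<And>x. incseq (\<lambda>n. h n x)" "\<And>x. (SUP n. ereal (h n x)) = ?I x"
    using approx_lsc[of ?I] by (metis ereal_less_eq(5) indicator_pos_le)
  moreover have "(\<lambda>n. h n x) \<longlonglongrightarrow> indicator U x" for x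
    using LIMSEQ_SUP[of "\<lambda>n. ereal (h n x)"] h(4,5)[of x] by (simp add: incseq_def)
  ultimately show ?thesis
    by (intro exI[of _ h]) simp
qed

lemma space_borel_of: "space (borel_of X) = UNIV"
  and sets_borel_of: "sets (borel_of X) = sigma_sets UNIV {U. openin X U}"
  by (simp_all add: borel_of_def topX space_measure_of_conv)

lemma continuous_map_borel_measurable:
  assumes f: "continuous_map X euclideanreal f" and Q: "sets Q = sets (borel_of X)"
  shows "f \<in> borel_measurable Q"
proof -
  have "f \<in> borel_measurable (borel_of X)"
  proof (rule borel_measurableI)
    fix S :: "real set" assume "open S"
    then have "openin X (f -` S)"
      using openin_preimage[OF f] by (simp add: vimage_def)
    then show "f -` S \<inter> space (borel_of X) \<in> sets (borel_of X)"
      by (auto simp: space_borel_of sets_borel_of)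
  qed
  then show ?thesis
    using Q measurable_cong_sets by blast
qed

lemma Cb_integrable:
  assumes f: "f \<in> Cb X" and Q: "finite_measure Q" "sets Q = sets (borel_of X)"
  shows "integrable Q f"
proof -
  interpret finite_measure Q by fact
  obtain B where "\<forall>x. \<bar>f x\<bar> \<le> B"
    using f unfolding Cb_def topX bounded_iff by auto
  then show ?thesis
    using continuous_map_borel_measurable[OF _ Q(2)] f
    by (intro integrable_const_bound[where B=B]) (auto simp: Cb_def)
qed

end

text \<open>Cuts y into slices of height at most 1. Applied to a nonnegative function of
  \<open>L\<close>, the slices stay in \<open>L\<close> and can be compared with indicators of
  superlevel sets.\<close>

lemma sum_layers:
  fixes y :: real assumes "0 \<le> y"
  shows "(\<Sum>k<m. min 1 (max 0 (y - real k))) = min (real m) y"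
  by (induction m) (use assms in \<open>auto simp: min_def max_def\<close>)

text \<open>The sum counts the integers k < m below y, so it exceeds y by at most 1. Scaling removes
  this excess in \<open>represented_by_measure\<close>.\<close>

lemma sum_indicator_layers:
  fixes y :: real assumes "0 \<le> y"
  shows "(\<Sum>k<m. indicator {real k<..} y) \<le> y + 1"
proof -
  have "(\<Sum>k<m. indicator {real k<..} y) \<le> min (real m) (y + 1)"
    by (induction m) (use assms in \<open>auto simp: min_def indicator_def split: if_splits\<close>)
  then show ?thesis by simp
qed

text \<open>A normalised Daniell integral. \<open>l_cont\<close> asks for one index only; as
  positivity makes \<open>l (fs n)\<close> decreasing, this amounts to convergence to 0.\<close>

locale daniell = lattice_space X L for X :: "'a topology" and L +
  fixes l :: "('a \<Rightarrow> real) \<Rightarrow> real"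
  assumes l_add: "f \<in> L \<Longrightarrow> g \<in> L \<Longrightarrow> l (\<lambda>x. f x + g x) = l f + l g"
    and l_scale: "f \<in> L \<Longrightarrow> l (\<lambda>x. a * f x) = a * l f"
    and l_nonneg: "f \<in> L \<Longrightarrow> (\<And>x. 0 \<le> f x) \<Longrightarrow> 0 \<le> l f"
    and l_one: "l (\<lambda>x. 1) = 1"
    and l_cont: "(\<And>n. fs n \<in> L) \<Longrightarrow> (\<And>x. decseq (\<lambda>n. fs n x)) \<Longrightarrow>
      (\<And>x. (\<lambda>n. fs n x) \<longlonglongrightarrow> 0) \<Longrightarrow> 0 < e \<Longrightarrow> \<exists>n. l (fs n) < e"
begin

lemma l_diff: "f \<in> L \<Longrightarrow> g \<in> L \<Longrightarrow> l (\<lambda>x. f x - g x) = l f - l g"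
  using l_add[of f "\<lambda>x. (-1) * g x"] l_scale[of g "-1"] L_scale[of g "-1"] by simp

lemma l_mono:
  assumes "f \<in> L" "g \<in> L" "\<And>x. f x \<le> g x"
  shows "l f \<le> l g"
  using l_nonneg[of "\<lambda>x. g x - f x"] l_diff[of g f] L_diff[of g f] assms by simp

lemma l_const: "l (\<lambda>x. a) = a"
  using l_scale[of "\<lambda>x. 1" a] l_one L_const by simp

lemma l_sum:
  fixes m :: nat
  assumes "\<And>k. f k \<in> L"
  shows "l (\<lambda>x. \<Sum>k<m. f k x) = (\<Sum>k<m. l (f k))"
  by (induction m) (use assms in \<open>auto simp: l_const l_add L_sum\<close>)

text \<open>Increasing sequences whose limit is at least 1 on A. The limit may be infinite, so it is
  tested by levels r < 1 and not by a real supremum.\<close>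

definition covers :: "'a set \<Rightarrow> (nat \<Rightarrow> 'a \<Rightarrow> real) set" where
  "covers A = {s. (\<forall>n. s n \<in> L) \<and> (\<forall>n x. 0 \<le> s n x) \<and> (\<forall>x. incseq (\<lambda>n. s n x)) \<and>
     (\<forall>x\<in>A. \<forall>r<1. \<exists>n. r < s n x)}"

text \<open>The Daniell upper integral of the indicator of A, with limits of increasing sequences in
  \<open>L\<close> as competing majorants.\<close>

definition om :: "'a set \<Rightarrow> ennreal" where
  "om A = (INF s\<in>covers A. SUP n. ennreal (l (s n)))"

lemma coversD:
  assumes "s \<in> covers A"
  shows "s n \<in> L" "0 \<le> s n x" "incseq (\<lambda>n. s n x)" "x \<in> A \<Longrightarrow> r < 1 \<Longrightarrow> \<exists>n. r < s n x"
  using assms unfolding covers_def by auto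

lemma coversI:
  assumes "\<And>n. s n \<in> L" "\<And>n x. 0 \<le> s n x" "\<And>x. incseq (\<lambda>n. s n x)"
    "\<And>x r. x \<in> A \<Longrightarrow> r < 1 \<Longrightarrow> \<exists>n. r < s n x"
  shows "s \<in> covers A"
  using assms unfolding covers_def by auto

lemma om_le: "s \<in> covers A \<Longrightarrow> om A \<le> (SUP n. ennreal (l (s n)))"
  unfolding om_def by (rule INF_lower)

lemma om_le_l:
  assumes "h \<in> L" "\<And>x. 0 \<le> h x" "\<And>x. x \<in> A \<Longrightarrow> 1 \<le> h x"
  shows "om A \<le> ennreal (l h)"
proof -
  have "(\<lambda>n. h) \<in> covers A"
    using assms by (intro coversI) (auto intro: order.strict_trans2)
  from om_le[OF this] show ?thesis by simp
qed

text \<open>This is where \<open>l_cont\<close> enters: along a cover s of A, the positive part of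
  \<open>h x - s n x\<close> decreases to 0, so \<open>l h\<close> exceeds a suitable
  \<open>l (s n)\<close> by as little as desired.\<close>

lemma l_le_om:
  assumes h: "h \<in> L" "\<And>x. h x \<le> indicator A x"
  shows "ennreal (l h) \<le> om A"
  unfolding om_def
proof (rule INF_greatest)
  fix s assume s: "s \<in> covers A"
  note s' = coversD[OF s]
  show "ennreal (l h) \<le> (SUP n. ennreal (l (s n)))"
  proof (rule ennreal_le_epsilon)
    fix e :: real assume e: "0 < e"
    define w where "w = (\<lambda>n x. max 0 (h x - s n x))"
    have wL: "w n \<in> L" for n
      unfolding w_def by (intro L_intros h s')
    have "(\<lambda>n. w n x) \<longlonglongrightarrow> 0" for x
    proof (rule LIMSEQ_I)
      fix r :: real assume r: "0 < r"
      show "\<exists>N. \<forall>n\<ge>N. norm (w n x - 0) < r"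
      proof (cases "x \<in> A")
        case True
        obtain N where N: "1 - r < s N x"
          using s'(4)[OF True, of "1 - r"] r by auto
        have "h x - s n x < r" if "n \<ge> N" for n
          using incseqD[OF s'(3) that, of x] N h(2)[of x] True by simp
        then show ?thesis
          using r by (intro exI[of _ N]) (auto simp: w_def)
      next
        case False
        have "w n x = 0" for n
          using h(2)[of x] s'(2)[of n x] False by (simp add: w_def)
        then show ?thesis using r by simp
      qed
    qed
    moreover have "decseq (\<lambda>n. w n x)" for x
      using incseqD[OF s'(3), of _ _ x] by (auto simp: w_def decseq_def intro: max.coboundedI2)
    ultimately obtain n where n: "l (w n) < e"
      using l_cont[of w e] wL e by blast
    have "l h \<le> l (\<lambda>x. s n x + w n x)"
      by (intro l_mono L_add h s' wL) (auto simp: w_def)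
    also have "\<dots> = l (s n) + l (w n)"
      using s' wL l_add by blast
    finally have "l h \<le> l (s n) + e" using n by simp
    then have "ennreal (l h) \<le> ennreal (l (s n)) + ennreal e"
      using l_nonneg[OF s'(1) s'(2)] e by (simp flip: ennreal_plus add: ennreal_leI)
    also have "\<dots> \<le> (SUP n. ennreal (l (s n))) + ennreal e"
      by (intro add_right_mono SUP_upper) simp
    finally show "ennreal (l h) \<le> (SUP n. ennreal (l (s n))) + ennreal e" .
  qed
qed

lemma om_UNIV: "om UNIV = 1"
  using om_le_l[of "\<lambda>x. 1" UNIV] l_le_om[of "\<lambda>x. 1" UNIV] L_const l_one by auto

lemma om_mono: "A \<subseteq> B \<Longrightarrow> om A \<le> om B"
  unfolding om_def by (rule INF_superset_mono) (auto simp: covers_def)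

text \<open>Covers of the \<open>A i\<close>, chosen with errors that sum to e, are added along the
  diagonal: stage n sums the n-th terms of the first n covers and so remains a finite sum in
  \<open>L\<close>.\<close>

lemma om_countably_subadditive: "om (\<Union>i. A i) \<le> (\<Sum>i. om (A i))" for A :: "nat \<Rightarrow> 'a set"
proof (rule ennreal_le_epsilon)
  fix e :: real assume e: "0 < e" "(\<Sum>i. om (A i)) < top"
  have "\<exists>s\<in>covers (A i). (SUP n. ennreal (l (s n))) \<le> om (A i) + e * (1/2) ^ Suc i" for i
  proof -
    \<comment> \<open>Every \<open>om (A i)\<close> is finite because the sum is, so adding a
      positive error gives a strict inequality.\<close>
    have "om (A i) < om (A i) + e * (1/2) ^ Suc i"
      using e by (auto simp: less_top dest!: ennreal_suminf_lessD)
    then show ?thesis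
      unfolding om_def INF_less_iff by (meson less_imp_le)
  qed
  then obtain s where s: "\<And>i. s i \<in> covers (A i)"
    and sl: "\<And>i. (SUP n. ennreal (l (s i n))) \<le> om (A i) + e * (1/2) ^ Suc i"
    by metis
  note s' = coversD[OF s]
  define t where "t = (\<lambda>n x. \<Sum>i<n. s i n x)"
  have "t \<in> covers (\<Union>i. A i)"
  proof (rule coversI)
    show "t n \<in> L" for n
      unfolding t_def by (intro L_sum s')
    show "0 \<le> t n x" for n x
      unfolding t_def by (intro sum_nonneg s')
    show "incseq (\<lambda>n. t n x)" for x
      unfolding t_def
    proof (rule incseq_SucI)
      fix n
      have "(\<Sum>i<n. s i n x) \<le> (\<Sum>i<n. s i (Suc n) x)"
        by (intro sum_mono incseq_SucD s')
      also have "\<dots> \<le> (\<Sum>i<Suc n. s i (Suc n) x)"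
        using s'(2) by simp
      finally show "(\<Sum>i<n. s i n x) \<le> (\<Sum>i<Suc n. s i (Suc n) x)" .
    qed
    fix x and r :: real assume "x \<in> (\<Union>i. A i)" "r < 1"
    then obtain i n where n: "r < s i n x"
      using s'(4) by blast
    \<comment> \<open>The i-th cover takes part in the diagonal sum only from stage
      \<open>Suc i\<close> on.\<close>
    let ?m = "max n (Suc i)"
    have "s i n x \<le> s i ?m x"
      by (rule incseqD[OF s'(3)]) simp
    also have "\<dots> \<le> t ?m x"
      unfolding t_def by (rule member_le_sum) (auto intro: s')
    finally show "\<exists>n. r < t n x" using n by (intro exI[of _ ?m]) simp
  qed
  then have "om (\<Union>i. A i) \<le> (SUP n. ennreal (l (t n)))"
    by (rule om_le)
  also have "\<dots> \<le> (\<Sum>i. om (A i) + e * (1/2) ^ Suc i)"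
  proof (rule SUP_least)
    fix n
    have "l (t n) = (\<Sum>i<n. l (s i n))"
      unfolding t_def by (rule l_sum) (rule s')
    then have "ennreal (l (t n)) = (\<Sum>i<n. ennreal (l (s i n)))"
      using l_nonneg[OF s'(1,2)] by simp
    also have "\<dots> \<le> (\<Sum>i<n. om (A i) + e * (1/2) ^ Suc i)"
      by (intro sum_mono order_trans[OF SUP_upper sl]) simp
    also have "\<dots> \<le> (\<Sum>i. om (A i) + e * (1/2) ^ Suc i)"
      by (intro sum_le_suminf) auto
    finally show "ennreal (l (t n)) \<le> (\<Sum>i. om (A i) + e * (1/2) ^ Suc i)" .
  qed
  also have "\<dots> = (\<Sum>i. om (A i)) + (\<Sum>i. ennreal e * ennreal ((1/2) ^ Suc i))"
    using e by (subst suminf_add[symmetric])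
      (auto simp del: ennreal_suminf_cmult simp add: ennreal_mult[symmetric])
  also have "\<dots> = (\<Sum>i. om (A i)) + e"
    unfolding ennreal_suminf_cmult
    by (subst suminf_ennreal_eq[OF zero_le_power power_half_series]) auto
  finally show "om (\<Union>i. A i) \<le> (\<Sum>i. om (A i)) + e" .
qed

lemma outer_measure_space_om: "outer_measure_space (Pow UNIV) om"
proof -
  have "om {} = 0"
    using om_le_l[of "\<lambda>x. 0" "{}"] L_const l_const by simp
  then show ?thesis
    using om_mono om_countably_subadditive
    by (auto simp: outer_measure_space_def positive_def increasing_def countably_subadditive_def)
qed

text \<open>The nontrivial half of Caratheodory's condition. Functions \<open>h k\<close> increasing
  to the indicator of U split a cover s of A: the minima with \<open>h k\<close> cover the part
  inside U along the diagonal, and for each k the remainders cover the part outside U.\<close>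

lemma om_split_open:
  assumes U: "openin X U"
  shows "om (A \<inter> U) + om (A - U) \<le> om A"
  unfolding om_def[of A]
proof (rule INF_greatest)
  fix s assume s: "s \<in> covers A"
  note s' = coversD[OF s]
  obtain h where "\<forall>n. h n \<in> L \<and> (\<forall>x. 0 \<le> h n x \<and> h n x \<le> indicator U x)"
    "\<forall>x. incseq (\<lambda>n. h n x) \<and> (\<lambda>n. h n x) \<longlonglongrightarrow> indicator U x"
    using approx_open[OF U] by auto
  then have h: "\<And>n. h n \<in> L" "\<And>n x. 0 \<le> h n x" "\<And>x. incseq (\<lambda>n. h n x)"
    and hU: "\<And>n x. h n x \<le> indicator U x"
    and h_lim: "\<And>x. (\<lambda>n. h n x) \<longlonglongrightarrow> indicator U x"
    by auto
  have h0: "h n x = 0" if "x \<notin> U" for n x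
    using h(2)[of n x] hU[of n x] that by simp
  have h1: "\<exists>n. r < h n x" if "x \<in> U" "r < 1" for r x
    using order_tendstoD(1)[OF h_lim, of r x] that by (auto simp: eventually_sequentially)
  let ?S = "SUP n. ennreal (l (s n))"
  define a where "a = (\<lambda>k n x. min (s n x) (h k x))"
  define b where "b = (\<lambda>k n x. max 0 (s n x - h k x))"
  have aL: "a k n \<in> L" "b k n \<in> L" for k n
    unfolding a_def b_def by (intro L_intros s' h)+
  have a0: "0 \<le> a k n x" "0 \<le> b k n x" for k n x
    using s'(2) h(2) by (auto simp: a_def b_def)
  have lab: "l (s n) = l (a k n) + l (b k n)" for k n
  proof -
    have "s n = (\<lambda>x. a k n x + b k n x)"
      by (auto simp: a_def b_def)
    then show ?thesis
      using l_add aL by metis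
  qed
  \<comment> \<open>Outside U every \<open>h k\<close> vanishes, so there \<open>b k n\<close>
    coincides with \<open>s n\<close>.\<close>
  have b_cov: "b k \<in> covers (A - U)" for k
  proof (rule coversI)
    show "incseq (\<lambda>n. b k n x)" for x
      using incseqD[OF s'(3), of _ _ x] by (auto simp: b_def incseq_def intro: max.coboundedI2)
    fix x and r :: real assume "x \<in> A - U" "r < 1"
    then show "\<exists>n. r < b k n x"
      using s'(4)[of x r] h0 by (auto simp: b_def less_max_iff_disj)
  qed (auto intro: aL a0)
  have "(\<lambda>k. a k k) \<in> covers (A \<inter> U)"
  proof (rule coversI)
    show "incseq (\<lambda>k. a k k x)" for x
      using incseqD[OF s'(3), of _ _ x] incseqD[OF h(3), of _ _ x] unfolding a_def incseq_def
      by (metis min.mono)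
    fix x and r :: real assume x: "x \<in> A \<inter> U" "r < 1"
    obtain n m where nm: "r < s n x" "r < h m x"
      using s'(4)[of x r] h1[of x r] x by auto
    have "s n x \<le> s (max n m) x" "h m x \<le> h (max n m) x"
      by (rule incseqD[OF s'(3)], simp, rule incseqD[OF h(3)], simp)
    then show "\<exists>n. r < a n n x"
      using nm by (intro exI[of _ "max n m"]) (auto simp: a_def)
  qed (auto intro: aL a0)
  then have "om (A \<inter> U) + om (A - U) \<le> (SUP k. ennreal (l (a k k))) + om (A - U)"
    by (intro add_right_mono om_le)
  also have "\<dots> = (SUP k. ennreal (l (a k k)) + om (A - U))"
    by (simp add: ennreal_SUP_add_left)
  also have "\<dots> \<le> ?S"
  proof (rule SUP_least)
    fix k
    have "ennreal (l (a k k)) + om (A - U) \<le> ennreal (l (a k k)) + (SUP n. ennreal (l (b k n)))"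
      by (intro add_left_mono om_le b_cov)
    also have "\<dots> = (SUP n. ennreal (l (a k k)) + ennreal (l (b k n)))"
      by (simp add: ennreal_SUP_add_right)
    also have "\<dots> \<le> ?S"
    proof (rule SUP_least)
      fix n
      \<comment> \<open>Only the index of s is raised; that of h stays k. Both parts then belong to
        the same splitting of \<open>s ?m\<close>, and \<open>lab\<close> applies.\<close>
      let ?m = "max k n"
      have "l (a k k) \<le> l (a k ?m)"
        using incseqD[OF s'(3), of k ?m] by (intro l_mono aL) (auto simp: a_def intro: min.coboundedI1)
      moreover have "l (b k n) \<le> l (b k ?m)"
        using incseqD[OF s'(3), of n ?m] by (intro l_mono aL) (auto simp: b_def intro: max.coboundedI2)
      ultimately have "ennreal (l (a k k)) + ennreal (l (b k n)) \<le> ennreal (l (s ?m))"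
        using lab[of ?m k] l_nonneg[OF aL(1) a0(1)] l_nonneg[OF aL(2) a0(2)]
        by (simp flip: ennreal_plus add: ennreal_leI)
      also have "\<dots> \<le> ?S"
        by (rule SUP_upper) simp
      finally show "ennreal (l (a k k)) + ennreal (l (b k n)) \<le> ?S" .
    qed
    finally show "ennreal (l (a k k)) + om (A - U) \<le> ?S" .
  qed
  finally show "om (A \<inter> U) + om (A - U) \<le> ?S" .
qed

lemma openin_lambda_system:
  assumes U: "openin X U"
  shows "U \<in> lambda_system UNIV (Pow UNIV) om"
proof -
  have oms: "positive (Pow UNIV) om" "countably_subadditive (Pow UNIV) om"
    using outer_measure_space_om by (auto simp: outer_measure_space_def)
  have "subadditive (Pow UNIV) om"
    by (rule ring_of_sets.countably_subadditive_subadditive[OF ring_of_sets_Pow oms])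
  then have "om A \<le> om (A \<inter> U) + om (A - U)" for A
    using subadditiveD[of "Pow UNIV" om "A \<inter> U" "A - U"] by (simp add: Int_Diff_Un Int_Diff_disjoint)
  then have "om (A \<inter> U) + om (A - U) = om A" for A
    using om_split_open[OF U, of A] by (simp add: order.eq_iff)
  then show ?thesis
    by (simp add: lambda_system_def Int_commute Diff_eq Compl_eq_Diff_UNIV[symmetric])
qed

text \<open>Open sets are Caratheodory measurable for \<open>om\<close>, which yields Q on the Borel
  sets. For equality of the integrals one inequality for nonnegative functions is enough, as it can
  be applied to both f + B and B - f with B a bound of f.\<close>

theorem represented_by_measure:
  "\<exists>Q\<in>borel_prob X. \<forall>f\<in>L. integral\<^sup>L Q f = l f"
proof -
  let ?S = "sigma_sets UNIV {U. openin X U}"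
  have ms: "measure_space UNIV (lambda_system UNIV (Pow UNIV) om) om"
    by (rule sigma_algebra.caratheodory_lemma[OF sigma_algebra_Pow outer_measure_space_om])
  have sub: "?S \<subseteq> lambda_system UNIV (Pow UNIV) om"
    using ms openin_lambda_system
    by (intro sigma_algebra.sigma_sets_subset) (auto simp: measure_space_def)
  define Q where "Q = measure_of UNIV ?S om"
  have sa: "sigma_algebra UNIV ?S"
    by (rule sigma_algebra_sigma_sets) simp
  have sets_Q: "sets Q = ?S" and space_Q: "space Q = UNIV"
    unfolding Q_def by (simp_all add: sigma_algebra.sets_measure_of_eq[OF sa] sigma_algebra.space_measure_of_eq[OF sa])
  have emQ: "emeasure Q A = om A" if "A \<in> ?S" for A
    unfolding Q_def
  proof (rule emeasure_measure_of_sigma[OF sa _ _ that])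
    show "positive ?S om"
      using ms by (auto simp: measure_space_def positive_def)
    show "countably_additive ?S om"
      using ms sub unfolding measure_space_def countably_additive_def by (meson order_trans subsetD)
  qed
  have "prob_space Q"
    by (rule prob_spaceI) (simp add: space_Q emQ om_UNIV sigma_sets_top)
  then interpret prob_space Q .
  have Q: "Q \<in> borel_prob X"
    using \<open>prob_space Q\<close> by (simp add: borel_prob_def sets_Q space_Q sets_borel_of topX)
  have int: "integrable Q f" if "f \<in> L" for f
    using that by (intro Cb_integrable L_Cb) (auto simp: sets_Q sets_borel_of finite_measure_axioms)
  \<comment> \<open>The slice of g at height k lies below the indicator of the set where g exceeds
    k, so \<open>l_le_om\<close> bounds its value by the measure of that set. Passing from slices to
    indicators costs at most 1 in total.\<close>
  have le1: "l g \<le> integral\<^sup>L Q g + 1" if g: "g \<in> L" "\<And>x. 0 \<le> g x" for g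
  proof -
    obtain B where B: "\<forall>x. \<bar>g x\<bar> \<le> B"
      using L_bounded[OF g(1)] by blast
    obtain m :: nat where m: "B \<le> real m"
      using real_arch_simple by blast
    define h where "h = (\<lambda>(k::nat) x. min 1 (max 0 (g x - real k)))"
    have hL: "h k \<in> L" for k
      unfolding h_def by (intro L_intros g)
    define G where "G = (\<lambda>k::nat. {x. g x \<in> {real k<..}})"
    have G: "G k \<in> sets Q" for k
      unfolding G_def sets_Q by (intro sigma_sets.Basic CollectI openin_preimage L_continuous g) simp
    have "g = (\<lambda>x. \<Sum>k<m. h k x)"
    proof
      fix x
      have "g x \<le> m" using B m by (metis abs_le_D1 order_trans)
      then show "g x = (\<Sum>k<m. h k x)"
        unfolding h_def by (subst sum_layers) (use g in auto)
    qed
    then have "l g = (\<Sum>k<m. l (h k))"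
      using l_sum[of h m] hL by simp
    also have "\<dots> \<le> (\<Sum>k<m. measure Q (G k))"
    proof (rule sum_mono)
      fix k
      have "ennreal (l (h k)) \<le> om (G k)"
        by (rule l_le_om[OF hL]) (auto simp: h_def G_def indicator_def)
      also have "\<dots> = ennreal (measure Q (G k))"
        using emQ[of "G k"] G sets_Q emeasure_eq_measure by simp
      finally show "l (h k) \<le> measure Q (G k)"
        by (simp add: ennreal_le_iff)
    qed
    also have "\<dots> = (\<integral>x. (\<Sum>k<m. indicator (G k) x) \<partial>Q)"
      using G by (subst Bochner_Integration.integral_sum) (auto simp: emeasure_eq_measure)
    also have "\<dots> \<le> (\<integral>x. g x + 1 \<partial>Q)"
    proof (rule integral_mono)
      show "integrable Q (\<lambda>x. \<Sum>k<m. indicator (G k) x :: real)"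
        using G by (intro Bochner_Integration.integrable_sum) (auto simp: emeasure_eq_measure)
      show "integrable Q (\<lambda>x. g x + 1)"
        by (intro int L_intros g)
      fix x
      show "(\<Sum>k<m. indicator (G k) x) \<le> g x + 1"
        using sum_indicator_layers[of "g x" m] g(2) by (simp add: G_def indicator_def)
    qed
    also have "\<dots> = integral\<^sup>L Q g + 1"
      using int[OF g(1)] by (simp add: prob_space)
    finally show ?thesis .
  qed
  have le: "l g \<le> integral\<^sup>L Q g" if g: "g \<in> L" "\<And>x. 0 \<le> g x" for g
  proof (rule field_le_epsilon)
    fix e :: real assume "0 < e"
    then obtain n :: nat where n: "1 / real (Suc n) < e"
      using nat_approx_posE by blast
    let ?N = "real (Suc n)"
    \<comment> \<open>Homogeneity divides the error 1 by \<open>?N\<close>.\<close>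
    have "?N * l g \<le> ?N * integral\<^sup>L Q g + 1"
      using le1[of "\<lambda>x. ?N * g x"] g by (simp add: L_scale l_scale del: of_nat_Suc)
    then have "l g \<le> integral\<^sup>L Q g + 1 / ?N"
      by (simp add: field_simps del: of_nat_Suc)
    then show "l g \<le> integral\<^sup>L Q g + e" using n by simp
  qed
  have "integral\<^sup>L Q f = l f" if f: "f \<in> L" for f
  proof -
    obtain B where B: "\<forall>x. \<bar>f x\<bar> \<le> B"
      using L_bounded[OF f] by blast
    have "l (\<lambda>x. f x + B) \<le> (\<integral>x. f x + B \<partial>Q)"
    proof (rule le)
      show "0 \<le> f x + B" for x using B by (smt (verit))
    qed (intro L_intros f)
    moreover have "l (\<lambda>x. B - f x) \<le> (\<integral>x. B - f x \<partial>Q)"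
    proof (rule le)
      show "0 \<le> B - f x" for x using B by (smt (verit))
    qed (intro L_intros f)
    ultimately show ?thesis
      using int[OF f] l_add[OF f L_const] l_diff[OF L_const f] by (simp add: l_const prob_space)
  qed
  then show ?thesis using Q by blast
qed

end

section \<open>Subadditivity of the extended capacity\<close>

context lattice_space
begin

text \<open>Finite intersections of base sets form a countable pi-system generating the Borel sets.
  Each of them is open, so its measure is the limit of the integrals of a sequence in
  \<open>L\<close>; D collects these sequences.\<close>

lemma countable_determining:
  obtains D where "D \<subseteq> L" "countable D"
    "\<And>P Q. P \<in> borel_prob X \<Longrightarrow> Q \<in> borel_prob X \<Longrightarrow>
      (\<And>d. d \<in> D \<Longrightarrow> integral\<^sup>L P d = integral\<^sup>L Q d) \<Longrightarrow> P = Q"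
proof -
  obtain B where B: "countable B" "\<forall>V\<in>B. openin X V"
    and Bb: "\<forall>U x. openin X U \<and> x \<in> U \<longrightarrow> (\<exists>V\<in>B. x \<in> V \<and> V \<subseteq> U)"
    using second_countable unfolding second_countable_def by (elim exE conjE)
  define E where "E = Inter ` {F. F \<subseteq> B \<and> finite F}"
  have "countable E"
    unfolding E_def using countable_Collect_finite_subset[OF B(1)] by (simp add: conj_commute)
  have E_open: "openin X U" if U: "U \<in> E" for U
  proof -
    obtain F where F: "F \<subseteq> B" "finite F" "U = \<Inter>F"
      using U unfolding E_def by auto
    show ?thesis
    proof (cases "F = {}")
      case True
      then show ?thesis using F topX openin_topspace[of X] by simp
    next
      case False
      then show ?thesis using F B(2) by (auto intro!: openin_Inter)
    qed
  qed
  have "B \<subseteq> E"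
  proof
    fix V assume "V \<in> B"
    then show "V \<in> E" unfolding E_def by (intro image_eqI[of _ _ "{V}"]) auto
  qed
  have "Int_stable E"
  proof (rule Int_stableI)
    fix U V assume "U \<in> E" "V \<in> E"
    then obtain F G where "F \<subseteq> B" "finite F" "U = \<Inter>F" "G \<subseteq> B" "finite G" "V = \<Inter>G"
      unfolding E_def by auto
    then show "U \<inter> V \<in> E"
      unfolding E_def by (intro image_eqI[of _ _ "F \<union> G"]) auto
  qed
  \<comment> \<open>The empty intersection gives the whole space, which is the exhausting set needed
    for uniqueness of measures.\<close>
  have UNIV_E: "UNIV \<in> E"
    unfolding E_def by (intro image_eqI[of _ _ "{}"]) auto
  have sig: "sigma_sets UNIV {U. openin X U} = sigma_sets UNIV E"
  proof (rule sigma_sets_eqI)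
    fix U assume "U \<in> {U. openin X U}"
    then have "U = \<Union>{V \<in> B. V \<subseteq> U}"
      using Bb by fast
    moreover have "countable {V \<in> B. V \<subseteq> U}"
      using B(1) by (rule countable_subset[rotated]) auto
    moreover have "{V \<in> B. V \<subseteq> U} \<subseteq> sigma_sets UNIV E"
      using \<open>B \<subseteq> E\<close> by auto
    ultimately show "U \<in> sigma_sets UNIV E"
      using sigma_algebra.countable_Union[OF sigma_algebra_sigma_sets, of E UNIV] by (metis subset_UNIV Pow_UNIV)
  qed (use E_open in auto)
  define approx where "approx U h \<longleftrightarrow> (\<forall>n. h n \<in> L \<and> (\<forall>x. 0 \<le> h n x \<and> h n x \<le> indicator U x)) \<and>
      (\<forall>x. incseq (\<lambda>n. h n x) \<and> (\<lambda>n. h n x) \<longlonglongrightarrow> indicator U x)" for U :: "'a set" and h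
  have "\<forall>U\<in>E. \<exists>h. approx U h"
    unfolding approx_def by (intro ballI approx_open E_open)
  from bchoice[OF this] obtain h where "\<forall>U\<in>E. approx U (h U)" ..
  then have h: "\<And>U. U \<in> E \<Longrightarrow> (\<forall>n. h U n \<in> L \<and> (\<forall>x. 0 \<le> h U n x \<and> h U n x \<le> indicator U x)) \<and>
      (\<forall>x. incseq (\<lambda>n. h U n x) \<and> (\<lambda>n. h U n x) \<longlonglongrightarrow> indicator U x)"
    unfolding approx_def by blast
  define D where "D = (\<lambda>(U, n). h U n) ` (E \<times> (UNIV :: nat set))"
  show thesis
  proof (rule that[of D])
    show "D \<subseteq> L"
      using h by (auto simp: D_def)
    show "countable D"
      unfolding D_def using \<open>countable E\<close> by blast
    have lim: "(\<lambda>n. integral\<^sup>L Q (h U n)) \<longlonglongrightarrow> measure Q U" if Q: "Q \<in> borel_prob X" and U: "U \<in> E" for Q U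
    proof -
      interpret prob_space Q
        using Q by (simp add: borel_prob_def)
      have setsQ: "sets Q = sets (borel_of X)"
        using Q by (simp add: borel_prob_def)
      have UQ: "U \<in> sets Q"
        using U E_open by (auto simp: setsQ sets_borel_of)
      have "(\<lambda>n. integral\<^sup>L Q (h U n)) \<longlonglongrightarrow> integral\<^sup>L Q (indicator U)"
      proof (rule integral_dominated_convergence[where w="\<lambda>_. 1"])
        show "AE x in Q. norm (h U n x) \<le> 1" for n
        proof (rule AE_I2)
          fix x
          have "0 \<le> h U n x \<and> h U n x \<le> indicator U x" using h[OF U] by blast
          then show "norm (h U n x) \<le> 1" by (cases "x \<in> U") auto
        qed
        show "h U n \<in> borel_measurable Q" for n
          using h[OF U] setsQ by (auto intro!: continuous_map_borel_measurable L_continuous)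
      qed (use h[OF U] UQ in auto)
      then show ?thesis
        using UQ by simp
    qed
    fix P Q assume PQ: "P \<in> borel_prob X" "Q \<in> borel_prob X"
      and eq: "\<And>d. d \<in> D \<Longrightarrow> integral\<^sup>L P d = integral\<^sup>L Q d"
    interpret P: prob_space P
      using PQ by (simp add: borel_prob_def)
    interpret Q: prob_space Q
      using PQ by (simp add: borel_prob_def)
    show "P = Q"
    proof (rule measure_eqI_generator_eq[of E UNIV P Q "\<lambda>_. UNIV"])
      fix U assume U: "U \<in> E"
      have "h U n \<in> D" for n
        using U by (auto simp: D_def)
      then have "measure P U = measure Q U"
        using lim[OF PQ(1) U] lim[OF PQ(2) U] eq LIMSEQ_unique by simp
      then show "emeasure P U = emeasure Q U"
        by (simp add: P.emeasure_eq_measure Q.emeasure_eq_measure)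
    qed (use PQ UNIV_E \<open>Int_stable E\<close> in \<open>auto simp: borel_prob_def sets_borel_of sig\<close>)
  qed
qed

lemma lsc_SUP:
  assumes "\<And>n::nat. continuous_map X euclideanreal (u n)"
  shows "lsc_on X (\<lambda>x. SUP n. ereal (u n x))"
  unfolding lsc_on_def
proof
  fix t :: ereal
  have "openin X {x. t < ereal (u n x)}" for n
  proof (cases t)
    case (real r)
    then have "{x. t < ereal (u n x)} = {x. u n x \<in> {r<..}}"
      by auto
    then show ?thesis
      using openin_preimage[OF assms, of "{r<..}" n] by simp
  qed (use topX openin_topspace[of X] in auto)
  moreover have "{x \<in> topspace X. t < (SUP n. ereal (u n x))} = (\<Union>n. {x. t < ereal (u n x)})"
    by (auto simp: topX less_SUP_iff)
  ultimately show "openin X {x \<in> topspace X. t < (SUP n. ereal (u n x))}"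
    by auto
qed

lemma lsc_continuous: "continuous_map X euclideanreal f \<Longrightarrow> lsc_on X (\<lambda>x. ereal (f x))"
  using lsc_SUP[of "\<lambda>_. f"] by simp

end

section \<open>Seminorm properties of the extended capacity\<close>

locale capacity_space = lattice_space X L for X :: "'a topology" and L +
  fixes c :: "('a \<Rightarrow> real) \<Rightarrow> real"
  assumes capacity: "capacity L c"
begin

abbreviation C where "C \<equiv> cap X L c"
abbreviation C_lsc where "C_lsc \<equiv> cap_lsc L c"
abbreviation L1 where "L1 \<equiv> L1set X L c"

lemma c_add: "f \<in> L \<Longrightarrow> g \<in> L \<Longrightarrow> c (\<lambda>x. f x + g x) \<le> c f + c g"
  using capacity unfolding capacity_def by (elim conjE) blast

lemma c_scale: "f \<in> L \<Longrightarrow> c (\<lambda>x. a * f x) = \<bar>a\<bar> * c f"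
  using capacity unfolding capacity_def by (elim conjE) blast

lemma c_mono: "f \<in> L \<Longrightarrow> g \<in> L \<Longrightarrow> (\<And>x. \<bar>f x\<bar> \<le> \<bar>g x\<bar>) \<Longrightarrow> c f \<le> c g"
  using capacity unfolding capacity_def by (elim conjE) blast

lemma c_zero: "c (\<lambda>x. 0) = 0"
  using c_scale[of "\<lambda>x. 0" 0] L_const by simp

lemma c_nonneg: "f \<in> L \<Longrightarrow> 0 \<le> c f"
  using c_mono[of "\<lambda>x. 0" f] L_const c_zero by simp

lemma c_cont:
  assumes "\<And>n. fs n \<in> L" "\<And>x. decseq (\<lambda>n. fs n x)" "\<And>x. (\<lambda>n. fs n x) \<longlonglongrightarrow> 0" "0 < e"
  shows "\<exists>n. c (fs n) < e"
proof -
  have "(INF n. c (fs n)) = 0"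
    using capacity assms unfolding capacity_def by auto
  then have "(INF n. c (fs n)) < e"
    using assms by simp
  moreover have "bdd_below (range (\<lambda>n. c (fs n)))"
    using c_nonneg assms by (intro bdd_belowI[of _ 0]) auto
  ultimately show ?thesis
    by (simp add: cINF_less_iff)
qed

lemma C_lsc_upper: "\<phi> \<in> L \<Longrightarrow> (\<And>x. 0 \<le> \<phi> x) \<Longrightarrow> (\<And>x. ereal (\<phi> x) \<le> f x) \<Longrightarrow> ereal (c \<phi>) \<le> C_lsc f"
  unfolding cap_lsc_def by (rule SUP_upper) simp

lemma C_lsc_nonneg: "(\<And>x. 0 \<le> f x) \<Longrightarrow> 0 \<le> C_lsc f"
  using C_lsc_upper[of "\<lambda>x. 0" f] L_const c_zero by (simp add: zero_ereal_def)

lemma C_upper: "lsc_on X f \<Longrightarrow> (\<And>x. ereal \<bar>g x\<bar> \<le> f x) \<Longrightarrow> C g \<le> C_lsc f"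
  unfolding cap_def by (rule INF_lower) simp

lemma C_greatest:
  "(\<And>f. lsc_on X f \<Longrightarrow> (\<And>x. 0 \<le> f x) \<Longrightarrow> (\<And>x. ereal \<bar>g x\<bar> \<le> f x) \<Longrightarrow> a \<le> C_lsc f) \<Longrightarrow> a \<le> C g"
  unfolding cap_def by (rule INF_greatest) (metis (no_types, lifting) mem_Collect_eq abs_ge_zero ereal_less_eq(5) order_trans)

lemma C_nonneg: "0 \<le> C g"
  by (rule C_greatest) (rule C_lsc_nonneg)

lemma C_less:
  assumes "C g < a"
  obtains f where "lsc_on X f" "\<And>x. 0 \<le> f x" "\<And>x. ereal \<bar>g x\<bar> \<le> f x" "C_lsc f < a"
proof -
  obtain f where f: "lsc_on X f" "\<And>x. ereal \<bar>g x\<bar> \<le> f x" "C_lsc f < a"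
    using assms unfolding cap_def INF_less_iff by auto
  have "0 \<le> f x" for x
    by (rule order_trans[OF _ f(2)]) simp
  then show thesis using that f by blast
qed

text \<open>The absolute value of \<phi> is continuous, hence itself an admissible majorant, and by
  monotonicity \<open>c\<close> depends on absolute values only.\<close>

lemma C_L:
  assumes "\<phi> \<in> L"
  shows "C \<phi> = ereal (c \<phi>)"
proof (rule antisym)
  have ab: "c (\<lambda>x. \<bar>\<phi> x\<bar>) = c \<phi>"
    using c_mono[OF L_abs[OF assms] assms] c_mono[OF assms L_abs[OF assms]] by simp
  have "C \<phi> \<le> C_lsc (\<lambda>x. ereal \<bar>\<phi> x\<bar>)"
    by (rule C_upper[OF lsc_continuous[OF L_continuous[OF L_abs[OF assms]]]]) simp
  also have "\<dots> \<le> ereal (c \<phi>)"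
    unfolding cap_lsc_def using assms by (intro SUP_least) (auto intro!: c_mono)
  finally show "C \<phi> \<le> ereal (c \<phi>)" .
  show "ereal (c \<phi>) \<le> C \<phi>"
    by (rule C_greatest) (use C_lsc_upper[OF L_abs[OF assms]] ab in simp)
qed

lemma C_minus: "C (\<lambda>x. g x - h x) = C (\<lambda>x. h x - g x)"
  by (simp add: cap_def abs_minus_commute)

text \<open>A minorant \<phi> of f + g need not split into minorants of f and g. It is compared with
  \<open>u n x + v n x\<close>, where u and v increase to f and g; the part of \<phi> above this sum
  decreases to 0, so its capacity becomes small.\<close>

lemma C_lsc_add:
  assumes f: "lsc_on X f" "\<And>x. 0 \<le> f x" and g: "lsc_on X g" "\<And>x. 0 \<le> g x"
  shows "lsc_on X (\<lambda>x. f x + g x) \<and> C_lsc (\<lambda>x. f x + g x) \<le> C_lsc f + C_lsc g"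
proof -
  obtain u where u: "\<And>n. u n \<in> L" "\<And>n x. 0 \<le> u n x" "\<And>n x. ereal (u n x) \<le> f x"
    "\<And>x. incseq (\<lambda>n. u n x)" "\<And>x. (SUP n. ereal (u n x)) = f x"
    using approx_lsc[OF f] by metis
  obtain v where v: "\<And>n. v n \<in> L" "\<And>n x. 0 \<le> v n x" "\<And>n x. ereal (v n x) \<le> g x"
    "\<And>x. incseq (\<lambda>n. v n x)" "\<And>x. (SUP n. ereal (v n x)) = g x"
    using approx_lsc[OF g] by metis
  have sup: "f x + g x = (SUP n. ereal (u n x + v n x))" for x
  proof -
    have "f x + g x = (SUP n. ereal (u n x)) + (SUP n. ereal (v n x))"
      by (simp add: u(5) v(5))
    also have "\<dots> = (SUP n. ereal (u n x) + ereal (v n x))"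
      by (rule SUP_ereal_add_pos[symmetric]) (use u v in \<open>auto simp: incseq_def\<close>)
    finally show ?thesis by simp
  qed
  have "lsc_on X (\<lambda>x. f x + g x)"
    unfolding sup by (intro lsc_SUP L_continuous L_intros u v)
  moreover have "C_lsc (\<lambda>x. f x + g x) \<le> C_lsc f + C_lsc g"
    unfolding cap_lsc_def[of L c "\<lambda>x. f x + g x"]
  proof (rule SUP_least, rule ereal_le_epsilon2)
    fix \<phi> and e :: real assume \<phi>: "\<phi> \<in> {\<phi> \<in> L. \<forall>x. 0 \<le> \<phi> x \<and> ereal (\<phi> x) \<le> f x + g x}" and e: "0 < e"
    define w where "w = (\<lambda>n x. max 0 (\<phi> x - (u n x + v n x)))"
    have wL: "w n \<in> L" for n
      unfolding w_def using \<phi> by (intro L_intros u v) auto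
    have mono: "u n x + v n x \<le> u m x + v m x" if "n \<le> m" for n m x
      using incseqD[OF u(4) that, of x] incseqD[OF v(4) that, of x] by simp
    have "(\<lambda>n. w n x) \<longlonglongrightarrow> 0" for x
    proof (rule LIMSEQ_I)
      fix r :: real assume r: "0 < r"
      have "ereal (\<phi> x - r) < ereal (\<phi> x)"
        using r by simp
      also have "\<dots> \<le> (SUP n. ereal (u n x + v n x))"
        using \<phi> sup by auto
      finally obtain N where "\<phi> x - r < u N x + v N x"
        by (auto simp: less_SUP_iff)
      then have "w n x < r" if "n \<ge> N" for n
        using mono[OF that, of x] r by (simp add: w_def)
      then show "\<exists>N. \<forall>n\<ge>N. norm (w n x - 0) < r"
        by (intro exI[of _ N]) (auto simp: w_def)
    qed
    moreover have "decseq (\<lambda>n. w n x)" for x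
      unfolding decseq_def w_def by (intro allI impI max.mono diff_left_mono mono order_refl)
    ultimately obtain n where n: "c (w n) < e"
      using c_cont[of w e] wL e by blast
    have "c \<phi> \<le> c (\<lambda>x. (u n x + v n x) + w n x)"
    proof (rule c_mono)
      show "\<bar>\<phi> x\<bar> \<le> \<bar>u n x + v n x + w n x\<bar>" for x
        using \<phi> u(2)[of n x] v(2)[of n x] by (auto simp: w_def)
    qed (use \<phi> in \<open>auto intro!: L_add u v wL\<close>)
    also have "\<dots> \<le> c (\<lambda>x. u n x + v n x) + c (w n)"
      by (intro c_add L_add u v wL)
    also have "\<dots> \<le> c (u n) + c (v n) + e"
      using c_add[OF u(1) v(1), of n n] n by simp
    finally have "ereal (c \<phi>) \<le> ereal (c (u n)) + ereal (c (v n)) + ereal e"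
      by simp
    also have "\<dots> \<le> C_lsc f + C_lsc g + ereal e"
      by (intro add_mono C_lsc_upper u v order_refl)
    finally show "ereal (c \<phi>) \<le> C_lsc f + C_lsc g + ereal e" .
  qed
  ultimately show ?thesis by blast
qed

lemma C_add: "C (\<lambda>x. g x + h x) \<le> C g + C h"
proof (cases "C g = \<infinity> \<or> C h = \<infinity>")
  case True
  then show ?thesis using C_nonneg[of g] C_nonneg[of h] by auto
next
  case False
  then obtain a b where ab: "C g = ereal a" "C h = ereal b"
    using C_nonneg[of g] C_nonneg[of h] by (cases "C g"; cases "C h") auto
  show ?thesis
  proof (rule ereal_le_epsilon2)
    fix e :: real assume e: "0 < e"
    obtain f where f: "lsc_on X f" "\<And>x. 0 \<le> f x" "\<And>x. ereal \<bar>g x\<bar> \<le> f x" "C_lsc f < ereal (a + e/2)"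
      by (rule C_less[of g "ereal (a + e/2)"]) (use ab e in auto)
    obtain k where k: "lsc_on X k" "\<And>x. 0 \<le> k x" "\<And>x. ereal \<bar>h x\<bar> \<le> k x" "C_lsc k < ereal (b + e/2)"
      by (rule C_less[of h "ereal (b + e/2)"]) (use ab e in auto)
    have "ereal \<bar>g x + h x\<bar> \<le> f x + k x" for x
    proof -
      have "ereal \<bar>g x + h x\<bar> \<le> ereal \<bar>g x\<bar> + ereal \<bar>h x\<bar>" by simp
      also have "\<dots> \<le> f x + k x" by (intro add_mono f k)
      finally show ?thesis .
    qed
    then have "C (\<lambda>x. g x + h x) \<le> C_lsc (\<lambda>x. f x + k x)"
      using C_lsc_add[OF f(1,2) k(1,2)] by (intro C_upper) auto
    also have "\<dots> \<le> C_lsc f + C_lsc k"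
      using C_lsc_add[OF f(1,2) k(1,2)] by blast
    also have "\<dots> \<le> ereal (a + e/2) + ereal (b + e/2)"
      using f(4) k(4) by (intro add_mono) auto
    finally show "C (\<lambda>x. g x + h x) \<le> C g + C h + ereal e"
      by (simp add: ab add_ac)
  qed
qed

lemma C_triangle: "C (\<lambda>x. f x - h x) \<le> C (\<lambda>x. g x - f x) + C (\<lambda>x. g x - h x)"
  using C_add[of "\<lambda>x. f x - g x" "\<lambda>x. g x - h x"] C_minus[of f g] by simp

text \<open>Stated for a real bound r, the form in which approximation errors appear. A majorant of
  g is scaled by the absolute value of a, and minorants of the result are scaled back.\<close>

lemma C_scale:
  assumes g: "C g \<le> ereal r"
  shows "C (\<lambda>x. a * g x) \<le> ereal (\<bar>a\<bar> * r)"
proof (cases "a = 0")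
  case True
  then show ?thesis using C_L[of "\<lambda>x. 0"] L_const c_zero by simp
next
  case a: False
  show ?thesis
  proof (rule ereal_le_epsilon2)
    fix e :: real assume e: "0 < e"
    \<comment> \<open>This error becomes e after multiplication by the absolute value of a.\<close>
    have "C g < ereal (r + e / \<bar>a\<bar>)"
      using g e a by (simp add: order.strict_trans1)
    then obtain f where f: "lsc_on X f" "\<And>x. 0 \<le> f x" "\<And>x. ereal \<bar>g x\<bar> \<le> f x" "C_lsc f < ereal (r + e / \<bar>a\<bar>)"
      by (rule C_less) auto
    obtain u where u: "\<And>n. u n \<in> L" "\<And>n x. 0 \<le> u n x" "\<And>n x. ereal (u n x) \<le> f x"
      "\<And>x. incseq (\<lambda>n. u n x)" "\<And>x. (SUP n. ereal (u n x)) = f x"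
      using approx_lsc[OF f(1,2)] by metis
    have eq: "ereal \<bar>a\<bar> * f x = (SUP n. ereal (\<bar>a\<bar> * u n x))" for x
      using SUP_ereal_mult_left[of UNIV "\<lambda>n. ereal (u n x)" "ereal \<bar>a\<bar>"] u(2,5) by simp
    have "lsc_on X (\<lambda>x. ereal \<bar>a\<bar> * f x)"
      unfolding eq by (intro lsc_SUP L_continuous L_intros u)
    moreover have "ereal \<bar>a * g x\<bar> \<le> ereal \<bar>a\<bar> * f x" for x
    proof -
      have "ereal \<bar>a * g x\<bar> = ereal \<bar>a\<bar> * ereal \<bar>g x\<bar>"
        by (simp add: abs_mult)
      also have "\<dots> \<le> ereal \<bar>a\<bar> * f x"
        by (intro ereal_mult_left_mono f) simp
      finally show ?thesis .
    qed
    ultimately have "C (\<lambda>x. a * g x) \<le> C_lsc (\<lambda>x. ereal \<bar>a\<bar> * f x)"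
      by (rule C_upper)
    also have "\<dots> \<le> ereal (\<bar>a\<bar> * (r + e / \<bar>a\<bar>))"
      unfolding cap_lsc_def
    proof (rule SUP_least)
      fix \<phi> assume \<phi>: "\<phi> \<in> {\<phi> \<in> L. \<forall>x. 0 \<le> \<phi> x \<and> ereal (\<phi> x) \<le> ereal \<bar>a\<bar> * f x}"
      define \<psi> where "\<psi> = (\<lambda>x. (1 / \<bar>a\<bar>) * \<phi> x)"
      have \<psi>L: "\<psi> \<in> L"
        unfolding \<psi>_def using \<phi> by (intro L_scale) simp
      have "\<phi> = (\<lambda>x. \<bar>a\<bar> * \<psi> x)"
        using a by (auto simp: \<psi>_def)
      then have c\<phi>: "c \<phi> = \<bar>a\<bar> * c \<psi>"
        using c_scale[OF \<psi>L, of "\<bar>a\<bar>"] by simp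
      have "ereal (\<psi> x) \<le> f x" for x
      proof -
        have "ereal (\<phi> x) \<le> ereal \<bar>a\<bar> * f x" using \<phi> by blast
        then show ?thesis
          using a by (cases "f x") (auto simp: \<psi>_def field_simps)
      qed
      moreover have "0 \<le> \<psi> x" for x
        using \<phi> by (simp add: \<psi>_def)
      ultimately have "ereal (c \<psi>) \<le> C_lsc f"
        using C_lsc_upper[OF \<psi>L] by blast
      then have "c \<psi> \<le> r + e / \<bar>a\<bar>"
        using f(4) by (meson ereal_less_eq(3) less_imp_le order_trans)
      then show "ereal (c \<phi>) \<le> ereal (\<bar>a\<bar> * (r + e / \<bar>a\<bar>))"
        unfolding c\<phi> by (simp add: mult_left_mono)
    qed
    finally show "C (\<lambda>x. a * g x) \<le> ereal (\<bar>a\<bar> * r) + ereal e"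
      using a by (simp add: distrib_left)
  qed
qed

section \<open>Vector space operations on L^1(c)\<close>

lemma L1_finite:
  assumes "g \<in> L1" obtains r where "C g = ereal r" "0 \<le> r"
  using assms C_nonneg[of g] by (cases "C g") (auto simp: L1set_def)

lemma L1_approx: "g \<in> L1 \<Longrightarrow> 0 < e \<Longrightarrow> \<exists>\<phi>\<in>L. C (\<lambda>x. g x - \<phi> x) < ereal e"
  by (auto simp: L1set_def)

lemma L_sub_L1: "\<phi> \<in> L \<Longrightarrow> \<phi> \<in> L1"
  using C_L[of "\<lambda>x. 0"] L_const c_zero unfolding L1set_def
  by (auto simp: C_L intro!: bexI[of _ \<phi>])

lemma L1_add:
  assumes "g \<in> L1" "h \<in> L1"
  shows "(\<lambda>x. g x + h x) \<in> L1"
  unfolding L1set_def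
proof (intro CollectI conjI allI impI)
  obtain r s where "C g = ereal r" "C h = ereal s"
    using L1_finite assms by metis
  then show "C (\<lambda>x. g x + h x) < \<infinity>"
    using C_add[of g h] by (auto intro: order.strict_trans1)
  fix e :: real assume "0 < e"
  then obtain \<phi> \<psi> where *: "\<phi> \<in> L" "C (\<lambda>x. g x - \<phi> x) < ereal (e/2)" "\<psi> \<in> L" "C (\<lambda>x. h x - \<psi> x) < ereal (e/2)"
    using L1_approx[OF assms(1), of "e/2"] L1_approx[OF assms(2), of "e/2"] by auto
  have "C (\<lambda>x. (g x + h x) - (\<phi> x + \<psi> x)) \<le> C (\<lambda>x. g x - \<phi> x) + C (\<lambda>x. h x - \<psi> x)"
    using C_add[of "\<lambda>x. g x - \<phi> x" "\<lambda>x. h x - \<psi> x"] by (simp add: algebra_simps)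
  also have "\<dots> < ereal (e/2) + ereal (e/2)"
    using * by (intro ereal_add_strict_mono2)
  finally show "\<exists>\<phi>\<in>L. C (\<lambda>x. (g x + h x) - \<phi> x) < ereal e"
    using * by (intro bexI[of _ "\<lambda>x. \<phi> x + \<psi> x"] L_add) auto
qed

lemma L1_scale:
  assumes "g \<in> L1"
  shows "(\<lambda>x. a * g x) \<in> L1"
  unfolding L1set_def
proof (intro CollectI conjI allI impI)
  obtain r where "C g = ereal r"
    using L1_finite assms by metis
  then show "C (\<lambda>x. a * g x) < \<infinity>"
    using C_scale[of g r a] by (auto intro: order.strict_trans1)
  fix e :: real assume e: "0 < e"
  \<comment> \<open>The added 1 covers a = 0 and makes the final inequality strict.\<close>
  then have "0 < e / (\<bar>a\<bar> + 1)" by simp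
  then obtain \<phi> where \<phi>: "\<phi> \<in> L" "C (\<lambda>x. g x - \<phi> x) < ereal (e / (\<bar>a\<bar> + 1))"
    using L1_approx[OF assms] by blast
  have "C (\<lambda>x. a * (g x - \<phi> x)) \<le> ereal (\<bar>a\<bar> * (e / (\<bar>a\<bar> + 1)))"
    using \<phi> by (intro C_scale) simp
  also have "\<dots> < ereal e"
    using e by (simp add: field_simps)
  finally show "\<exists>\<phi>\<in>L. C (\<lambda>x. a * g x - \<phi> x) < ereal e"
    using \<phi> by (intro bexI[of _ "\<lambda>x. a * \<phi> x"] L_scale) (auto simp: algebra_simps)
qed

lemma L1_uminus: "g \<in> L1 \<Longrightarrow> (\<lambda>x. - g x) \<in> L1"
  using L1_scale[of g "-1"] by simp

end

section \<open>The dual of $L^1(c)$\<close>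

lemma eq_if_close:
  fixes v w k :: real
  assumes "\<And>e. 0 < e \<Longrightarrow> \<bar>v - w\<bar> \<le> k * e" shows "v = w"
proof (rule ccontr)
  assume "v \<noteq> w"
  then have "0 < \<bar>v - w\<bar> / (2 * (\<bar>k\<bar> + 1))" by simp
  then have "\<bar>v - w\<bar> \<le> k * (\<bar>v - w\<bar> / (2 * (\<bar>k\<bar> + 1)))"
    by (rule assms)
  also have "\<dots> \<le> (\<bar>k\<bar> + 1) * (\<bar>v - w\<bar> / (2 * (\<bar>k\<bar> + 1)))"
    by (rule mult_right_mono) auto
  also have "\<dots> = \<bar>v - w\<bar> / 2" by (simp add: field_simps)
  finally show False using \<open>v \<noteq> w\<close> by simp
qed

context capacity_space
begin

text \<open>A linear modulus b in place of the epsilon-delta condition of \<open>EQ\<close>, so that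
  errors can be added. For g in \<open>L1\<close> and b \<ge> 0 it determines v, by
  \<open>EQ_eqI\<close>.\<close>

definition extends :: "real \<Rightarrow> 'a measure \<Rightarrow> ('a \<Rightarrow> real) \<Rightarrow> real \<Rightarrow> bool" where
  "extends b Q g v \<longleftrightarrow> (\<forall>\<phi>\<in>L. \<forall>e. C (\<lambda>x. g x - \<phi> x) \<le> ereal e \<longrightarrow> \<bar>integral\<^sup>L Q \<phi> - v\<bar> \<le> b * e)"

lemma EQ_eqI:
  assumes g: "g \<in> L1" and b: "0 \<le> b" and v: "extends b Q g v"
  shows "EQ X L c Q g = v"
proof -
  let ?lim = "\<lambda>v. \<forall>e>0. \<exists>d>0. \<forall>\<phi>\<in>L. C (\<lambda>x. g x - \<phi> x) < ereal d \<longrightarrow> \<bar>integral\<^sup>L Q \<phi> - v\<bar> < e"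
  have "?lim v"
  proof (intro allI impI)
    fix e :: real assume e: "0 < e"
    show "\<exists>d>0. \<forall>\<phi>\<in>L. C (\<lambda>x. g x - \<phi> x) < ereal d \<longrightarrow> \<bar>integral\<^sup>L Q \<phi> - v\<bar> < e"
    proof (intro exI[of _ "e / (b + 1)"] conjI ballI impI)
      fix \<phi> assume "\<phi> \<in> L" "C (\<lambda>x. g x - \<phi> x) < ereal (e / (b + 1))"
      then have "\<bar>integral\<^sup>L Q \<phi> - v\<bar> \<le> b * (e / (b + 1))"
        using v unfolding extends_def by (meson less_imp_le)
      also have "\<dots> < e"
        using e b by (simp add: field_simps)
      finally show "\<bar>integral\<^sup>L Q \<phi> - v\<bar> < e" .
    qed (use e b in simp)
  qed
  moreover have "w = v" if w: "?lim w" for w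
  proof (rule ccontr)
    assume "w \<noteq> v"
    then have e: "0 < \<bar>w - v\<bar> / 2" by simp
    obtain d where d: "d > 0" "\<forall>\<phi>\<in>L. C (\<lambda>x. g x - \<phi> x) < ereal d \<longrightarrow> \<bar>integral\<^sup>L Q \<phi> - w\<bar> < \<bar>w - v\<bar> / 2"
      using w e by blast
    obtain d' where d': "d' > 0" "\<forall>\<phi>\<in>L. C (\<lambda>x. g x - \<phi> x) < ereal d' \<longrightarrow> \<bar>integral\<^sup>L Q \<phi> - v\<bar> < \<bar>w - v\<bar> / 2"
      using \<open>?lim v\<close> e by blast
    obtain \<phi> where \<phi>: "\<phi> \<in> L" "C (\<lambda>x. g x - \<phi> x) < ereal (min d d')"
      using L1_approx[OF g, of "min d d'"] d d' by auto
    have "C (\<lambda>x. g x - \<phi> x) < ereal d" "C (\<lambda>x. g x - \<phi> x) < ereal d'"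
      using \<phi>(2) by (auto elim: order.strict_trans2)
    then have "\<bar>integral\<^sup>L Q \<phi> - w\<bar> < \<bar>w - v\<bar> / 2" "\<bar>integral\<^sup>L Q \<phi> - v\<bar> < \<bar>w - v\<bar> / 2"
      using d d' \<phi>(1) by blast+
    then show False
      by (simp add: abs_if split: if_splits)
  qed
  ultimately show ?thesis
    unfolding EQ_def by (rule the_equality)
qed

end

locale dual_measure = capacity_space X L c for X :: "'a topology" and L and c +
  fixes Q :: "'a measure" and b :: real
  assumes Q: "Q \<in> borel_prob X" and b_nonneg: "0 \<le> b"
    and bound: "f \<in> L \<Longrightarrow> \<bar>integral\<^sup>L Q f\<bar> \<le> b * c f"
begin

abbreviation E where "E \<equiv> EQ X L c Q"

sublocale prob_space Q
  using Q by (simp add: borel_prob_def)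

lemma integrable_L: "f \<in> L \<Longrightarrow> integrable Q f"
  using Q by (intro Cb_integrable L_Cb) (auto simp: borel_prob_def finite_measure_axioms)

lemma integral_close:
  assumes \<phi>: "\<phi> \<in> L" "C (\<lambda>x. g x - \<phi> x) \<le> ereal r" and \<psi>: "\<psi> \<in> L" "C (\<lambda>x. g x - \<psi> x) \<le> ereal s"
  shows "\<bar>integral\<^sup>L Q \<phi> - integral\<^sup>L Q \<psi>\<bar> \<le> b * (r + s)"
proof -
  have "ereal (c (\<lambda>x. \<phi> x - \<psi> x)) = C (\<lambda>x. \<phi> x - \<psi> x)"
    by (rule C_L[symmetric]) (intro L_intros \<phi> \<psi>)
  also have "\<dots> \<le> C (\<lambda>x. g x - \<phi> x) + C (\<lambda>x. g x - \<psi> x)"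
    by (rule C_triangle)
  also have "\<dots> \<le> ereal r + ereal s"
    by (intro add_mono \<phi> \<psi>)
  finally have "c (\<lambda>x. \<phi> x - \<psi> x) \<le> r + s" by simp
  then have "b * c (\<lambda>x. \<phi> x - \<psi> x) \<le> b * (r + s)"
    using b_nonneg by (rule mult_left_mono)
  then show ?thesis
    using bound[OF L_diff[OF \<phi>(1) \<psi>(1)]] integrable_L[OF \<phi>(1)] integrable_L[OF \<psi>(1)] by simp
qed

text \<open>By \<open>integral_close\<close> the integrals along a sequence in \<open>L\<close>
  approximating g are Cauchy. The same estimate against an arbitrary \<psi> in \<open>L\<close>
  passes to the limit, since the error of the sequence vanishes.\<close>

lemma extends_E:
  assumes g: "g \<in> L1"
  shows "extends b Q g (E g)"
proof -
  have "\<exists>\<phi>\<in>L. C (\<lambda>x. g x - \<phi> x) < ereal (1 / real (Suc n))" for n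
    using L1_approx[OF g, of "1 / real (Suc n)"] by simp
  then obtain \<phi> where \<phi>: "\<And>n. \<phi> n \<in> L" "\<And>n. C (\<lambda>x. g x - \<phi> n x) < ereal (1 / real (Suc n))"
    by metis
  note \<phi>' = \<phi>(1) less_imp_le[OF \<phi>(2)]
  have lim: "(\<lambda>n. b * (e + 1 / real (Suc n))) \<longlonglongrightarrow> b * (e + 0)" for e
    by (intro tendsto_intros LIMSEQ_Suc[OF lim_1_over_n])
  have "Cauchy (\<lambda>n. integral\<^sup>L Q (\<phi> n))"
  proof (rule metric_CauchyI)
    fix e :: real assume e: "0 < e"
    have "(\<lambda>n. b * (1 / real (Suc n))) \<longlonglongrightarrow> 0"
      using lim[of 0] by simp
    from order_tendstoD(2)[OF this, of "e / 2"]
    have "\<forall>\<^sub>F n in sequentially. b * (1 / real (Suc n)) < e / 2"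
      using e by simp
    then obtain N where N: "\<And>n. n \<ge> N \<Longrightarrow> b * (1 / real (Suc n)) < e / 2"
      by (auto simp: eventually_sequentially)
    show "\<exists>M. \<forall>m\<ge>M. \<forall>n\<ge>M. dist (integral\<^sup>L Q (\<phi> m)) (integral\<^sup>L Q (\<phi> n)) < e"
    proof (intro exI[of _ N] allI impI)
      fix m n assume mn: "N \<le> m" "N \<le> n"
      have "dist (integral\<^sup>L Q (\<phi> m)) (integral\<^sup>L Q (\<phi> n)) \<le> b * (1 / real (Suc m)) + b * (1 / real (Suc n))"
        using integral_close[OF \<phi>'(1,2) \<phi>'(1,2), of m n] by (simp add: dist_real_def distrib_left)
      also have "\<dots> < e"
        using N[OF mn(1)] N[OF mn(2)] by linarith
      finally show "dist (integral\<^sup>L Q (\<phi> m)) (integral\<^sup>L Q (\<phi> n)) < e" .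
    qed
  qed
  then obtain v where v: "(\<lambda>n. integral\<^sup>L Q (\<phi> n)) \<longlonglongrightarrow> v"
    using Cauchy_convergent convergent_def by blast
  have "extends b Q g v"
    unfolding extends_def
  proof (intro ballI allI impI)
    fix \<psi> e assume \<psi>: "\<psi> \<in> L" "C (\<lambda>x. g x - \<psi> x) \<le> ereal e"
    have "(\<lambda>n. \<bar>integral\<^sup>L Q \<psi> - integral\<^sup>L Q (\<phi> n)\<bar>) \<longlonglongrightarrow> \<bar>integral\<^sup>L Q \<psi> - v\<bar>"
      by (intro tendsto_intros v)
    from LIMSEQ_le[OF this lim[of e]] show "\<bar>integral\<^sup>L Q \<psi> - v\<bar> \<le> b * e"
      using integral_close[OF \<psi> \<phi>'(1,2)] by auto
  qed
  then show ?thesis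
    using EQ_eqI[OF g b_nonneg] by simp
qed

lemma E_close:
  assumes "g \<in> L1" "\<phi> \<in> L" "C (\<lambda>x. g x - \<phi> x) \<le> ereal e"
  shows "\<bar>integral\<^sup>L Q \<phi> - E g\<bar> \<le> b * e"
  using extends_E[OF assms(1)] assms unfolding extends_def by blast

lemma E_L:
  assumes "\<phi> \<in> L" shows "E \<phi> = integral\<^sup>L Q \<phi>"
  using E_close[OF L_sub_L1[OF assms] assms, of 0] C_L[of "\<lambda>x. 0"] L_const c_zero by simp

lemma E_add:
  assumes g: "g \<in> L1" and h: "h \<in> L1"
  shows "E (\<lambda>x. g x + h x) = E g + E h"
proof (rule eq_if_close[where k="4 * b"])
  fix e :: real assume e: "0 < e"
  obtain \<phi> where \<phi>: "\<phi> \<in> L" "C (\<lambda>x. g x - \<phi> x) < ereal e"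
    using L1_approx[OF g e] by blast
  obtain \<psi> where \<psi>: "\<psi> \<in> L" "C (\<lambda>x. h x - \<psi> x) < ereal e"
    using L1_approx[OF h e] by blast
  have "C (\<lambda>x. (g x + h x) - (\<phi> x + \<psi> x)) \<le> C (\<lambda>x. g x - \<phi> x) + C (\<lambda>x. h x - \<psi> x)"
    using C_add[of "\<lambda>x. g x - \<phi> x" "\<lambda>x. h x - \<psi> x"] by (simp add: algebra_simps)
  also have "\<dots> \<le> ereal e + ereal e"
    using \<phi> \<psi> by (intro add_mono) auto
  finally have "C (\<lambda>x. (g x + h x) - (\<phi> x + \<psi> x)) \<le> ereal (2 * e)" by simp
  then have "\<bar>(\<integral>x. \<phi> x + \<psi> x \<partial>Q) - E (\<lambda>x. g x + h x)\<bar> \<le> b * (2 * e)"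
    by (intro E_close L1_add g h L_add \<phi> \<psi>)
  moreover have "(\<integral>x. \<phi> x + \<psi> x \<partial>Q) = integral\<^sup>L Q \<phi> + integral\<^sup>L Q \<psi>"
    using \<phi> \<psi> integrable_L by simp
  moreover have "\<bar>integral\<^sup>L Q \<phi> - E g\<bar> \<le> b * e" "\<bar>integral\<^sup>L Q \<psi> - E h\<bar> \<le> b * e"
    using E_close[OF g \<phi>(1)] E_close[OF h \<psi>(1)] \<phi> \<psi> by auto
  \<comment> \<open>Approximating the sum costs \<open>2 * b * e\<close>, and approximating g and h
    costs \<open>b * e\<close> each.\<close>
  ultimately show "\<bar>E (\<lambda>x. g x + h x) - (E g + E h)\<bar> \<le> 4 * b * e"
    by argo
qed

lemma E_scale:
  assumes g: "g \<in> L1"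
  shows "E (\<lambda>x. a * g x) = a * E g"
proof (rule eq_if_close[where k="2 * \<bar>a\<bar> * b"])
  fix e :: real assume e: "0 < e"
  obtain \<phi> where \<phi>: "\<phi> \<in> L" "C (\<lambda>x. g x - \<phi> x) < ereal e"
    using L1_approx[OF g e] by blast
  have "C (\<lambda>x. a * g x - a * \<phi> x) \<le> ereal (\<bar>a\<bar> * e)"
    using C_scale[of "\<lambda>x. g x - \<phi> x" e a] \<phi> by (simp add: algebra_simps)
  then have "\<bar>(\<integral>x. a * \<phi> x \<partial>Q) - E (\<lambda>x. a * g x)\<bar> \<le> b * (\<bar>a\<bar> * e)"
    by (intro E_close L1_scale g L_scale \<phi>)
  moreover have "\<bar>a * integral\<^sup>L Q \<phi> - a * E g\<bar> \<le> \<bar>a\<bar> * (b * e)"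
    using E_close[OF g \<phi>(1), of e] \<phi> by (simp add: abs_mult mult_left_mono flip: right_diff_distrib)
  ultimately show "\<bar>E (\<lambda>x. a * g x) - a * E g\<bar> \<le> 2 * \<bar>a\<bar> * b * e"
    by (simp add: algebra_simps)
qed

lemma EQform_L1_dual: "EQform X L c Q \<in> L1_dual X L c"
  unfolding L1_dual_def
proof (intro CollectI conjI ballI allI exI[of _ b])
  fix g assume g: "g \<in> L1"
  obtain r where r: "C g = ereal r"
    using L1_finite g by blast
  \<comment> \<open>The zero function approximates g with error \<open>C g\<close>, which turns
    \<open>E_close\<close> into the norm bound.\<close>
  have "\<bar>E g\<bar> \<le> b * r"
    using E_close[OF g L_const, of 0 r] r by simp
  then show "ereal \<bar>EQform X L c Q g\<bar> \<le> ereal b * C g"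
    using g by (simp add: EQform_def r)
qed (auto simp: EQform_def L1_add L1_scale E_add E_scale)

end

section \<open>From bounded linear forms to measures\<close>

context capacity_space
begin

lemma dual_probE:
  assumes "Q \<in> dual_prob X L c"
  obtains b where "dual_measure X L c Q b"
proof -
  obtain b where b: "\<And>f. f \<in> L \<Longrightarrow> \<bar>integral\<^sup>L Q f\<bar> \<le> b * c f" and Q: "Q \<in> borel_prob X"
    using assms unfolding dual_prob_def by blast
  \<comment> \<open>The constant in \<open>dual_prob\<close> may be negative, whereas
    \<open>dual_measure\<close> requires a nonnegative one.\<close>
  have "\<bar>integral\<^sup>L Q f\<bar> \<le> max b 0 * c f" if "f \<in> L" for f
    using b[OF that] c_nonneg[OF that] by (meson max.cobounded1 mult_right_mono order_trans)
  then have "dual_measure X L c Q (max b 0)"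
    using Q by unfold_locales auto
  then show thesis by (rule that)
qed

lemma L1_dual_add: "l \<in> L1_dual X L c \<Longrightarrow> g \<in> L1 \<Longrightarrow> h \<in> L1 \<Longrightarrow> l (\<lambda>x. g x + h x) = l g + l h"
  and L1_dual_scale: "l \<in> L1_dual X L c \<Longrightarrow> g \<in> L1 \<Longrightarrow> l (\<lambda>x. a * g x) = a * l g"
  unfolding L1_dual_def by simp_all

lemma L1_dual_bound:
  assumes l: "l \<in> L1_dual X L c"
  shows "\<exists>k\<ge>0. \<forall>g\<in>L1. \<forall>e. C g \<le> ereal e \<longrightarrow> \<bar>l g\<bar> \<le> k * e"
proof -
  obtain k where k: "\<forall>g\<in>L1. ereal \<bar>l g\<bar> \<le> ereal k * C g"
    using l unfolding L1_dual_def by blast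
  have "\<bar>l g\<bar> \<le> \<bar>k\<bar> * e" if g: "g \<in> L1" "C g \<le> ereal e" for g e
  proof -
    obtain r where r: "C g = ereal r" "0 \<le> r"
      using L1_finite g by blast
    have "\<bar>l g\<bar> \<le> k * r"
      using bspec[OF k g(1)] r by simp
    also have "\<dots> \<le> \<bar>k\<bar> * e"
      using r g by (intro mult_mono) auto
    finally show ?thesis .
  qed
  then show ?thesis
    by (intro exI[of _ "\<bar>k\<bar>"]) simp
qed

text \<open>\<open>L\<close> is dense in L^1(c), so a bounded form is determined by its values on
  \<open>L\<close>. The bound of l serves as the modulus in \<open>extends\<close>.\<close>

lemma L1_dual_representation:
  assumes l: "l \<in> L1_dual X L c" and Q: "Q \<in> borel_prob X"
    and eq: "\<And>\<phi>. \<phi> \<in> L \<Longrightarrow> integral\<^sup>L Q \<phi> = l \<phi>"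
  shows "Q \<in> dual_prob X L c" "EQform X L c Q = l"
proof -
  obtain k where k: "0 \<le> k" and l_bound: "\<And>g e. g \<in> L1 \<Longrightarrow> C g \<le> ereal e \<Longrightarrow> \<bar>l g\<bar> \<le> k * e"
    using L1_dual_bound[OF l] by blast
  have "\<bar>integral\<^sup>L Q \<phi>\<bar> \<le> k * c \<phi>" if "\<phi> \<in> L" for \<phi>
    using l_bound[OF L_sub_L1[OF that], of "c \<phi>"] C_L[OF that] eq[OF that] by simp
  then show "Q \<in> dual_prob X L c"
    using Q unfolding dual_prob_def by blast
  have "EQ X L c Q g = l g" if g: "g \<in> L1" for g
  proof (rule EQ_eqI[OF g])
    show "extends k Q g (l g)"
      unfolding extends_def
    proof (intro ballI allI impI)
      fix \<phi> e assume \<phi>: "\<phi> \<in> L" "C (\<lambda>x. g x - \<phi> x) \<le> ereal e"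
      have m: "(\<lambda>x. (-1) * \<phi> x) \<in> L1"
        using \<phi>(1) by (intro L1_scale L_sub_L1)
      have "(\<lambda>x. g x - \<phi> x) \<in> L1"
        using L1_add[OF g m] by simp
      then have "\<bar>l (\<lambda>x. g x - \<phi> x)\<bar> \<le> k * e"
        using \<phi>(2) by (rule l_bound)
      moreover have "l (\<lambda>x. g x - \<phi> x) = l g - l \<phi>"
        using L1_dual_add[OF l g m] L1_dual_scale[OF l L_sub_L1[OF \<phi>(1)], of "-1"] by simp
      ultimately show "\<bar>integral\<^sup>L Q \<phi> - l g\<bar> \<le> k * e"
        using eq[OF \<phi>(1)] by (simp add: abs_minus_commute)
    qed
  qed (rule k)
  moreover have "l \<in> extensional L1"
    using l by (simp add: L1_dual_def)
  ultimately show "EQform X L c Q = l"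
    by (auto simp: EQform_def extensional_def)
qed

text \<open>The bound of l by a multiple of \<open>c\<close> transfers sequential continuity from
  \<open>c\<close> to l, which is the Daniell condition. Density then extends the representation
  from \<open>L\<close> to L^1(c).\<close>

lemma L1_dual_positive_is_measure:
  assumes l: "l \<in> L1_dual X L c" and pos: "\<And>\<phi>. \<phi> \<in> L \<Longrightarrow> (\<And>x. 0 \<le> \<phi> x) \<Longrightarrow> 0 \<le> l \<phi>"
    and one: "l (\<lambda>x. 1) = 1"
  obtains Q where "Q \<in> dual_prob X L c" "EQform X L c Q = l"
proof -
  obtain k where k: "0 \<le> k" and l_bound: "\<And>g e. g \<in> L1 \<Longrightarrow> C g \<le> ereal e \<Longrightarrow> \<bar>l g\<bar> \<le> k * e"
    using L1_dual_bound[OF l] by blast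
  interpret daniell X L l
  proof unfold_locales
    show "l (\<lambda>x. f x + g x) = l f + l g" if "f \<in> L" "g \<in> L" for f g
      using L1_dual_add[OF l] that L_sub_L1 by blast
    show "l (\<lambda>x. a * f x) = a * l f" if "f \<in> L" for f a
      using L1_dual_scale[OF l] that L_sub_L1 by blast
    fix fs :: "nat \<Rightarrow> 'a \<Rightarrow> real" and e :: real
    assume fs: "\<And>n. fs n \<in> L" "\<And>x. decseq (\<lambda>n. fs n x)" "\<And>x. (\<lambda>n. fs n x) \<longlonglongrightarrow> 0" "0 < e"
    obtain n where n: "c (fs n) < e / (k + 1)"
      using c_cont[OF fs(1-3), of "e / (k + 1)"] fs(4) k by auto
    have "l (fs n) \<le> k * c (fs n)"
      using l_bound[OF L_sub_L1[OF fs(1)], of n "c (fs n)"] C_L[OF fs(1)] by simp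
    also have "\<dots> \<le> k * (e / (k + 1))"
      using n k by (intro mult_left_mono) auto
    also have "\<dots> < e"
      using fs(4) k by (simp add: field_simps)
    finally show "\<exists>n. l (fs n) < e" ..
  qed (use pos one in auto)
  obtain Q where "Q \<in> borel_prob X" "\<forall>f\<in>L. integral\<^sup>L Q f = l f"
    using represented_by_measure by blast
  then show thesis
    using L1_dual_representation[OF l] that by blast
qed

end

section \<open>Compact sets of scenarios\<close>

context lattice_space
begin

text \<open>\<open>approx_lsc\<close> requires a nonnegative function, so f is shifted by a bound B;
  subtracting B from the approximants keeps them in \<open>L\<close>.\<close>

lemma Cb_approx:
  assumes f: "f \<in> Cb X"
  obtains v where "\<forall>n. v n \<in> L" "\<forall>n x. v n x \<le> f x" "\<forall>x. incseq (\<lambda>n. v n x)"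
    "\<forall>x. (\<lambda>n. v n x) \<longlonglongrightarrow> f x"
proof -
  obtain B where B: "\<forall>x. \<bar>f x\<bar> \<le> B"
    using f unfolding Cb_def topX bounded_iff by auto
  have fc: "continuous_map X euclideanreal f"
    using f by (simp add: Cb_def)
  have 1: "lsc_on X (\<lambda>x. ereal (f x + B))"
    by (intro lsc_continuous continuous_map_add fc continuous_map_const[THEN iffD2]) simp
  have 2: "0 \<le> ereal (f x + B)" for x
    using B[rule_format, of x] by (simp add: abs_le_iff)
  obtain u where u: "\<And>n. u n \<in> L" "\<And>n x. 0 \<le> u n x" "\<And>n x. ereal (u n x) \<le> ereal (f x + B)"
    "\<And>x. incseq (\<lambda>n. u n x)" "\<And>x. (SUP n. ereal (u n x)) = ereal (f x + B)"
    using approx_lsc[of "\<lambda>x. ereal (f x + B)", OF 1 2] by metis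
  show thesis
  proof (rule that[of "\<lambda>n x. u n x - B"])
    show "\<forall>n. (\<lambda>x. u n x - B) \<in> L"
      by (intro allI L_intros u)
    show "\<forall>n x. u n x - B \<le> f x"
      using u(3) by (simp add: algebra_simps)
    show "\<forall>x. incseq (\<lambda>n. u n x - B)"
      using u(4) by (simp add: incseq_def)
    show "\<forall>x. (\<lambda>n. u n x - B) \<longlonglongrightarrow> f x"
    proof
      fix x
      have "(\<lambda>n. ereal (u n x)) \<longlonglongrightarrow> ereal (f x + B)"
        using LIMSEQ_SUP[of "\<lambda>n. ereal (u n x)"] u(4,5)[of x] by (simp add: incseq_def)
      then have "(\<lambda>n. u n x) \<longlonglongrightarrow> f x + B"
        by simp
      from tendsto_diff[OF this tendsto_const[of B]] show "(\<lambda>n. u n x - B) \<longlonglongrightarrow> f x"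
        by simp
    qed
  qed
qed

text \<open>Each bounded continuous function is an increasing limit of elements of \<open>L\<close>, so the integrals
  of elements of \<open>L\<close> control its integral from below; applied to \<open>f\<close> and \<open>- f\<close> this gives
  weak continuity.\<close>

lemma continuous_map_integral_if_L:
  fixes Q :: "'b \<Rightarrow> 'a measure"
  assumes Q: "\<And>t. t \<in> topspace T \<Longrightarrow> Q t \<in> borel_prob X"
    and cont: "\<And>\<phi>. \<phi> \<in> L \<Longrightarrow> continuous_map T euclideanreal (\<lambda>t. integral\<^sup>L (Q t) \<phi>)"
    and f: "f \<in> Cb X"
  shows "continuous_map T euclideanreal (\<lambda>t. integral\<^sup>L (Q t) f)"
proof -
  have lower: "openin T {t \<in> topspace T. a < integral\<^sup>L (Q t) g}" if g: "g \<in> Cb X" for a g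
  proof -
    obtain v where v: "\<forall>n. v n \<in> L" "\<forall>n x. v n x \<le> g x" "\<forall>x. incseq (\<lambda>n. v n x)"
      "\<forall>x. (\<lambda>n. v n x) \<longlonglongrightarrow> g x"
      by (rule Cb_approx[OF g])
    have "a < integral\<^sup>L (Q t) g \<longleftrightarrow> (\<exists>n. a < integral\<^sup>L (Q t) (v n))" if t: "t \<in> topspace T" for t
    proof -
      have fin: "finite_measure (Q t)" and sets: "sets (Q t) = sets (borel_of X)"
        using Q[OF t] by (auto simp: borel_prob_def prob_space_def)
      have int: "integrable (Q t) h" if "h \<in> Cb X" for h
        by (rule Cb_integrable[OF that fin sets])
      have vI: "integrable (Q t) (v n)" for n
        using v(1) by (intro int L_Cb) simp
      \<comment> \<open>Monotonicity places every \<open>v n\<close> between \<open>v 0\<close> and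
        g, which provides the dominating function.\<close>
      have "(\<lambda>n. integral\<^sup>L (Q t) (v n)) \<longlonglongrightarrow> integral\<^sup>L (Q t) g"
      proof (rule integral_dominated_convergence[where w="\<lambda>x. \<bar>v 0 x\<bar> + \<bar>g x\<bar>"])
        show "AE x in Q t. norm (v n x) \<le> \<bar>v 0 x\<bar> + \<bar>g x\<bar>" for n
        proof (rule AE_I2)
          fix x
          have "v 0 x \<le> v n x" "v n x \<le> g x"
            using v(2,3) by (auto simp: incseq_def)
          then show "norm (v n x) \<le> \<bar>v 0 x\<bar> + \<bar>g x\<bar>" by simp
        qed
        show "integrable (Q t) (\<lambda>x. \<bar>v 0 x\<bar> + \<bar>g x\<bar>)"
          using vI[of 0] int[OF g] by simp
      qed (use v int[OF g] vI borel_measurable_integrable in auto)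
      then have "a < integral\<^sup>L (Q t) g \<Longrightarrow> \<exists>n. a < integral\<^sup>L (Q t) (v n)"
        by (blast dest: order_tendstoD(1) eventually_happens'[OF sequentially_bot])
      moreover have "integral\<^sup>L (Q t) (v n) \<le> integral\<^sup>L (Q t) g" for n
        using v(2) by (intro integral_mono vI int[OF g]) simp
      ultimately show ?thesis
        using order.strict_trans2 by blast
    qed
    then have "{t \<in> topspace T. a < integral\<^sup>L (Q t) g}
        = (\<Union>n. {t \<in> topspace T. integral\<^sup>L (Q t) (v n) \<in> {a<..}})"
      by auto
    also have "openin T \<dots>"
    proof (intro openin_Union ballI, elim imageE, hypsubst)
      show "openin T {t \<in> topspace T. integral\<^sup>L (Q t) (v n) \<in> {a<..}}" for n
        using v(1) by (intro openin_continuous_map_preimage[OF cont]) auto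
    qed
    finally show ?thesis .
  qed
  have "(\<lambda>x. - f x) \<in> Cb X"
    using f by (auto simp: Cb_def bounded_iff)
  then have "openin T {t \<in> topspace T. integral\<^sup>L (Q t) f < a}" for a
    using lower[of "\<lambda>x. - f x" "- a"] by simp
  then show ?thesis
    using lower[OF f] by (simp add: continuous_map_upper_lower_semicontinuous_lt)
qed

lemma continuous_map_weak_topology_integral:
  assumes f: "f \<in> Cb X"
  shows "continuous_map (weak_topology X) euclideanreal (\<lambda>\<mu>. integral\<^sup>L \<mu> f)"
proof -
  have "continuous_map (weak_topology X) euclideanreal ((\<lambda>k. k f) \<circ> (\<lambda>\<mu>. \<lambda>f\<in>Cb X. integral\<^sup>L \<mu> f))"
    unfolding weak_topology_def
    by (intro continuous_map_pullback continuous_map_product_projection f)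
  then show ?thesis
    using f by (simp add: comp_def)
qed

lemma continuous_map_into_weak_topology:
  assumes Q: "\<And>t. t \<in> topspace T \<Longrightarrow> Q t \<in> borel_prob X"
    and cont: "\<And>f. f \<in> Cb X \<Longrightarrow> continuous_map T euclideanreal (\<lambda>t. integral\<^sup>L (Q t) f)"
  shows "continuous_map T (weak_topology X) Q"
  unfolding weak_topology_def
proof (rule continuous_map_pullback')
  show "continuous_map T (product_topology (\<lambda>_. euclideanreal) (Cb X)) ((\<lambda>\<mu>. \<lambda>f\<in>Cb X. integral\<^sup>L \<mu> f) \<circ> Q)"
    using cont by (auto simp: continuous_map_componentwise comp_def)
  show "topspace T \<subseteq> Q -` borel_finite X"
    using Q by (auto simp: borel_finite_def borel_prob_def prob_space_def)
qed

end

section \<open>The weak* closure as a set of forms and as a set of measures\<close>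

locale compact_scenarios = capacity_space X L c for X :: "'a topology" and L c +
  fixes \<Q> :: "'a measure set"
  assumes \<Q>_dual: "\<Q> \<subseteq> dual_prob X L c"
    and compact_closure: "compactin (weak_star X L c) (weak_star X L c closure_of (EQform X L c ` \<Q>))"
begin

abbreviation "W \<equiv> weak_star X L c"
definition "Qbar = W closure_of (EQform X L c ` \<Q>)"
text \<open>The closure is taken among linear forms, whereas the weak topology lives on measures;
  this set carries the closure over to measures.\<close>

definition "QbarM = {Q \<in> dual_prob X L c. EQform X L c Q \<in> Qbar}"

lemma topspace_W: "topspace W = L1_dual X L c"
proof -
  have "L1_dual X L c \<subseteq> extensional L1"
    unfolding L1_dual_def by blast
  then show ?thesis
    unfolding weak_star_def by (auto simp: PiE_def)
qed

lemma eval_continuous: "g \<in> L1 \<Longrightarrow> continuous_map W euclideanreal (\<lambda>l. l g)"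
  unfolding weak_star_def
  by (intro continuous_map_from_subtopology continuous_map_product_projection)

lemma Qbar_sub: "Qbar \<subseteq> L1_dual X L c"
  unfolding Qbar_def topspace_W[symmetric] by (rule closure_of_subset_topspace)

lemma EQform_Q_in_Qbar: "Q \<in> \<Q> \<Longrightarrow> EQform X L c Q \<in> Qbar"
proof -
  have "EQform X L c ` \<Q> \<subseteq> topspace W"
  proof
    fix l assume "l \<in> EQform X L c ` \<Q>"
    then obtain Q where Q: "l = EQform X L c Q" "Q \<in> dual_prob X L c"
      using \<Q>_dual by blast
    obtain b where "dual_measure X L c Q b"
      using dual_probE[OF Q(2)] .
    then show "l \<in> topspace W"
      using dual_measure.EQform_L1_dual Q(1) topspace_W by metis
  qed
  then show "Q \<in> \<Q> \<Longrightarrow> EQform X L c Q \<in> Qbar"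
    unfolding Qbar_def using closure_of_subset by blast
qed

lemma EQform_L:
  assumes "Q \<in> dual_prob X L c" "\<phi> \<in> L"
  shows "EQform X L c Q \<phi> = integral\<^sup>L Q \<phi>"
proof -
  obtain b where "dual_measure X L c Q b"
    using dual_probE[OF assms(1)] .
  then show ?thesis
    using dual_measure.E_L assms(2) L_sub_L1 by (simp add: EQform_def)
qed

text \<open>Evaluation at \<phi> is weak* continuous, so closed constraints on integrals pass to the
  closure. The cases needed are positivity, \<open>{0..}\<close>, and normalisation,
  \<open>{1}\<close>.\<close>

lemma Qbar_closed_condition:
  assumes \<phi>: "\<phi> \<in> L" and S: "closed S" and Q: "\<And>Q. Q \<in> \<Q> \<Longrightarrow> integral\<^sup>L Q \<phi> \<in> S"
    and l: "l \<in> Qbar"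
  shows "l \<phi> \<in> S"
proof -
  have "closedin W {l \<in> topspace W. l \<phi> \<in> S}"
    using S by (intro closedin_continuous_map_preimage[OF eval_continuous] L_sub_L1 \<phi>) simp
  moreover have "EQform X L c ` \<Q> \<subseteq> {l \<in> topspace W. l \<phi> \<in> S}"
    using Q \<Q>_dual EQform_L \<phi> EQform_Q_in_Qbar Qbar_sub topspace_W by fastforce
  ultimately have "Qbar \<subseteq> {l \<in> topspace W. l \<phi> \<in> S}"
    unfolding Qbar_def by (intro closure_of_minimal)
  then show ?thesis
    using l by blast
qed

lemma Qbar_eq: "Qbar = EQform X L c ` QbarM"
proof
  show "EQform X L c ` QbarM \<subseteq> Qbar"
    by (auto simp: QbarM_def)
  show "Qbar \<subseteq> EQform X L c ` QbarM"
  proof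
    fix l assume l: "l \<in> Qbar"
    have "0 \<le> l \<phi>" if "\<phi> \<in> L" "\<And>x. 0 \<le> \<phi> x" for \<phi>
      using Qbar_closed_condition[OF that(1) _ _ l, of "{0..}"] that(2) by simp
    moreover have "l (\<lambda>x. 1) = 1"
    proof -
      have "integral\<^sup>L Q (\<lambda>x. 1) \<in> {1 :: real}" if "Q \<in> \<Q>" for Q
      proof -
        have "prob_space Q"
          using that \<Q>_dual by (auto simp: dual_prob_def borel_prob_def)
        then show ?thesis
          by (simp add: prob_space.prob_space)
      qed
      then show ?thesis
        using Qbar_closed_condition[OF L_const _ _ l, of "{1}" 1] by simp
    qed
    moreover have "l \<in> L1_dual X L c"
      using l Qbar_sub by blast
    ultimately obtain Q where "Q \<in> dual_prob X L c" "EQform X L c Q = l"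
      using L1_dual_positive_is_measure by metis
    then show "l \<in> EQform X L c ` QbarM"
      using l by (auto simp: QbarM_def)
  qed
qed

lemma QbarM_borel_prob: "Q \<in> QbarM \<Longrightarrow> Q \<in> borel_prob X"
  by (simp add: QbarM_def dual_prob_def)

lemma QbarM_EQform_L: "Q \<in> QbarM \<Longrightarrow> \<phi> \<in> L \<Longrightarrow> EQform X L c Q \<phi> = integral\<^sup>L Q \<phi>"
  by (simp add: QbarM_def EQform_L)

definition measure_of_form :: "(('a \<Rightarrow> real) \<Rightarrow> real) \<Rightarrow> 'a measure" where
  "measure_of_form = inv_into QbarM (EQform X L c)"

lemma measure_of_form:
  assumes "l \<in> Qbar"
  shows "measure_of_form l \<in> QbarM" "EQform X L c (measure_of_form l) = l"
  using assms inv_into_into[of l "EQform X L c" QbarM] f_inv_into_f[of l "EQform X L c" QbarM]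
  by (simp_all add: Qbar_eq[symmetric] measure_of_form_def)

lemma inj_EQform: "inj_on (EQform X L c) QbarM"
proof (rule inj_onI)
  fix P Q assume PQ: "P \<in> QbarM" "Q \<in> QbarM" "EQform X L c P = EQform X L c Q"
  obtain D where D: "D \<subseteq> L" "countable D"
    "\<And>P Q. P \<in> borel_prob X \<Longrightarrow> Q \<in> borel_prob X \<Longrightarrow>
      (\<And>d. d \<in> D \<Longrightarrow> integral\<^sup>L P d = integral\<^sup>L Q d) \<Longrightarrow> P = Q"
    using countable_determining by metis
  show "P = Q"
  proof (rule D(3))
    fix d assume "d \<in> D"
    then show "integral\<^sup>L P d = integral\<^sup>L Q d"
      using QbarM_EQform_L[OF PQ(1), of d] QbarM_EQform_L[OF PQ(2), of d] PQ(3) D(1) by auto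
  qed (use PQ QbarM_borel_prob in auto)
qed

lemma measure_of_form_image: "measure_of_form ` Qbar = QbarM"
  unfolding measure_of_form_def Qbar_eq by (rule inv_into_image_cancel[OF inj_EQform]) simp

lemma topspace_Qbar: "topspace (subtopology W Qbar) = Qbar"
  using Qbar_sub topspace_W by auto

lemma compact_space_Qbar: "compact_space (subtopology W Qbar)"
  using compact_closure unfolding Qbar_def by (rule compact_space_subtopology)

lemma eval_continuous_Qbar: "g \<in> L1 \<Longrightarrow> continuous_map (subtopology W Qbar) euclideanreal (\<lambda>l. l g)"
  by (intro continuous_map_from_subtopology eval_continuous)

text \<open>A form in the closure is recovered from its representing measure, and this measure from
  countably many integrals. These integrals are weak* continuous evaluations of the form.\<close>

lemma metrizable_Qbar: "metrizable_space (subtopology W Qbar)"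
proof -
  obtain D where D: "D \<subseteq> L" "countable D"
    "\<And>P Q. P \<in> borel_prob X \<Longrightarrow> Q \<in> borel_prob X \<Longrightarrow>
      (\<And>d. d \<in> D \<Longrightarrow> integral\<^sup>L P d = integral\<^sup>L Q d) \<Longrightarrow> P = Q"
    using countable_determining by metis
  show ?thesis
  proof (rule compact_metrizable_if_countably_separated[OF compact_space_Qbar D(2), of "\<lambda>d l. l d"])
    show "continuous_map (subtopology W Qbar) euclideanreal (\<lambda>l. l d)" if "d \<in> D" for d
      using that D(1) L_sub_L1 by (intro eval_continuous_Qbar) auto
    fix k l assume "k \<in> topspace (subtopology W Qbar)" "l \<in> topspace (subtopology W Qbar)"
      and eq: "\<And>d. d \<in> D \<Longrightarrow> k d = l d"
    then have k: "k \<in> Qbar" and l: "l \<in> Qbar"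
      using topspace_Qbar by auto
    note mk = measure_of_form[OF k] and ml = measure_of_form[OF l]
    have "measure_of_form k = measure_of_form l"
    proof (rule D(3))
      fix d assume d: "d \<in> D"
      then show "integral\<^sup>L (measure_of_form k) d = integral\<^sup>L (measure_of_form l) d"
        using QbarM_EQform_L[OF mk(1), of d] QbarM_EQform_L[OF ml(1), of d] eq[OF d] D(1) mk(2) ml(2) by auto
    qed (use mk ml QbarM_borel_prob in auto)
    then show "k = l"
      using mk(2) ml(2) by metis
  qed
qed

text \<open>For \<phi> in \<open>L\<close> the integral against \<open>measure_of_form l\<close> is
  \<open>l \<phi>\<close>, which is weak* continuous in l;
  \<open>continuous_map_integral_if_L\<close> passes from \<open>L\<close> to all bounded continuous
  functions.\<close>

lemma continuous_measure_of_form: "continuous_map (subtopology W Qbar) (weak_topology X) measure_of_form"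
proof (rule continuous_map_into_weak_topology)
  show prob: "measure_of_form l \<in> borel_prob X" if "l \<in> topspace (subtopology W Qbar)" for l
    using that measure_of_form(1) QbarM_borel_prob topspace_Qbar by blast
  fix f assume f: "f \<in> Cb X"
  show "continuous_map (subtopology W Qbar) euclideanreal (\<lambda>l. integral\<^sup>L (measure_of_form l) f)"
  proof (rule continuous_map_integral_if_L[OF prob _ f])
    fix \<phi> assume \<phi>: "\<phi> \<in> L"
    have "l \<phi> = integral\<^sup>L (measure_of_form l) \<phi>" if "l \<in> topspace (subtopology W Qbar)" for l
      using that QbarM_EQform_L[OF measure_of_form(1) \<phi>] measure_of_form(2) topspace_Qbar by metis
    then show "continuous_map (subtopology W Qbar) euclideanreal (\<lambda>l. integral\<^sup>L (measure_of_form l) \<phi>)"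
      by (rule continuous_map_eq[OF eval_continuous_Qbar[OF L_sub_L1[OF \<phi>]]])
  qed
qed

lemma compact_QbarM: "compactin (weak_topology X) QbarM"
proof -
  have "compactin (subtopology W Qbar) Qbar"
    using compact_space_Qbar topspace_Qbar unfolding compact_space_def by simp
  from image_compactin[OF this continuous_measure_of_form] show ?thesis
    by (simp add: measure_of_form_image)
qed

text \<open>The determining class lies in \<open>L\<close>, hence in \<open>Cb X\<close>, so its
  integrals are also weakly continuous.\<close>

lemma metrizable_QbarM: "metrizable_space (subtopology (weak_topology X) QbarM)"
proof -
  obtain D where D: "D \<subseteq> L" "countable D"
    "\<And>P Q. P \<in> borel_prob X \<Longrightarrow> Q \<in> borel_prob X \<Longrightarrow>
      (\<And>d. d \<in> D \<Longrightarrow> integral\<^sup>L P d = integral\<^sup>L Q d) \<Longrightarrow> P = Q"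
    using countable_determining by metis
  show ?thesis
  proof (rule compact_metrizable_if_countably_separated[OF _ D(2), of _ "\<lambda>d Q. integral\<^sup>L Q d"])
    show "compact_space (subtopology (weak_topology X) QbarM)"
      by (rule compact_space_subtopology[OF compact_QbarM])
    show "continuous_map (subtopology (weak_topology X) QbarM) euclideanreal (\<lambda>Q. integral\<^sup>L Q d)" if "d \<in> D" for d
      using that D(1) by (intro continuous_map_from_subtopology continuous_map_weak_topology_integral L_Cb) auto
    fix P Q assume "P \<in> topspace (subtopology (weak_topology X) QbarM)" "Q \<in> topspace (subtopology (weak_topology X) QbarM)"
      and eq: "\<And>d. d \<in> D \<Longrightarrow> integral\<^sup>L P d = integral\<^sup>L Q d"
    then show "P = Q"
      using QbarM_borel_prob by (intro D(3)) auto
  qed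
qed

text \<open>The near-optimality conditions \<open>l (- g) - l (- Y) + \<rho> Y \<ge> \<rho> g - 1 / n\<close> for all \<open>Y\<close> cut out
  nested nonempty closed subsets of the closure; a point of their intersection is optimal.\<close>

lemma supremum_attained:
  assumes rep: "\<forall>g\<in>L1. ereal (\<rho> g) = (SUP Q\<in>\<Q>. ereal (EQ X L c Q (\<lambda>x. - g x)) - penalty X L c \<rho> Q)"
    and g: "g \<in> L1"
  shows "\<exists>Q\<in>QbarM. ereal (\<rho> g) = ereal (EQ X L c Q (\<lambda>x. - g x)) - penalty X L c \<rho> Q"
proof -
  \<comment> \<open>The supremum over Y in the penalty is unfolded into one real inequality per Y,
    each continuous in l; a possibly infinite penalty never appears.\<close>
  define F where "F n = {l \<in> Qbar. \<forall>Y\<in>L1. \<rho> g - 1 / real (Suc n) \<le> l (\<lambda>x. - g x) - l (\<lambda>x. - Y x) + \<rho> Y}" for n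
  have "(\<Inter>n. F n) \<noteq> {}"
  proof (rule compact_space_imp_nest[OF compact_space_Qbar])
    fix n
    let ?T = "subtopology W Qbar"
    have "F n = (\<Inter>Y\<in>L1. {l \<in> topspace ?T. l (\<lambda>x. - g x) - l (\<lambda>x. - Y x) + \<rho> Y \<in> {\<rho> g - 1 / real (Suc n)..}})"
      using g unfolding F_def topspace_Qbar by auto
    also have "closedin ?T \<dots>"
    proof (rule closedin_INT)
      show "L1 \<noteq> {}" using g by blast
      fix Y assume Y: "Y \<in> L1"
      have "continuous_map ?T euclideanreal (\<lambda>l. l (\<lambda>x. - g x) - l (\<lambda>x. - Y x) + \<rho> Y)"
        by (intro continuous_map_add continuous_map_diff eval_continuous_Qbar L1_uminus g Y) simp
      then show "closedin ?T {l \<in> topspace ?T. l (\<lambda>x. - g x) - l (\<lambda>x. - Y x) + \<rho> Y \<in> {\<rho> g - 1 / real (Suc n)..}}"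
        by (rule closedin_continuous_map_preimage) simp
    qed
    finally show "closedin ?T (F n)" .
    have "ereal (\<rho> g - 1 / real (Suc n)) < ereal (\<rho> g)"
      by simp
    also have "\<dots> = (SUP Q\<in>\<Q>. ereal (EQ X L c Q (\<lambda>x. - g x)) - penalty X L c \<rho> Q)"
      using rep g by blast
    finally obtain Q where Q: "Q \<in> \<Q>"
      and less: "ereal (\<rho> g - 1 / real (Suc n)) < ereal (EQ X L c Q (\<lambda>x. - g x)) - penalty X L c \<rho> Q"
      by (auto simp: less_SUP_iff)
    have "\<rho> g - 1 / real (Suc n) \<le> EQ X L c Q (\<lambda>x. - g x) - EQ X L c Q (\<lambda>x. - Y x) + \<rho> Y" if Y: "Y \<in> L1" for Y
    proof -
      \<comment> \<open>Replacing the penalty by a single term of its supremum can only enlarge the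
        difference, so near-optimality of Q yields every constraint at once.\<close>
      have "ereal (EQ X L c Q (\<lambda>x. - Y x) - \<rho> Y) \<le> penalty X L c \<rho> Q"
        unfolding penalty_def using Y by (rule SUP_upper)
      then have "ereal (EQ X L c Q (\<lambda>x. - g x)) - penalty X L c \<rho> Q
          \<le> ereal (EQ X L c Q (\<lambda>x. - g x)) - ereal (EQ X L c Q (\<lambda>x. - Y x) - \<rho> Y)"
        by (intro ereal_minus_mono order_refl)
      from order.strict_trans2[OF less this] show ?thesis by simp
    qed
    then have "EQform X L c Q \<in> F n"
      using EQform_Q_in_Qbar[OF Q] g L1_uminus by (simp add: F_def EQform_def)
    then show "F n \<noteq> {}" by blast
  next
    show "decseq F"
    proof (rule decseq_SucI)
      fix n
      have "1 / real (Suc (Suc n)) \<le> 1 / real (Suc n)"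
        by (simp add: frac_le)
      then show "F (Suc n) \<subseteq> F n"
        unfolding F_def by fastforce
    qed
  qed
  then obtain l where l: "\<And>n. l \<in> F n"
    by blast
  then have "l \<in> Qbar"
    unfolding F_def by blast
  then obtain Q where Q: "Q \<in> QbarM" "l = EQform X L c Q"
    using Qbar_eq by blast
  have opt: "EQ X L c Q (\<lambda>x. - Y x) - \<rho> Y \<le> EQ X L c Q (\<lambda>x. - g x) - \<rho> g" if Y: "Y \<in> L1" for Y
  proof (rule field_le_epsilon)
    fix e :: real assume "0 < e"
    then obtain n :: nat where n: "1 / real (Suc n) < e"
      using nat_approx_posE by blast
    have "\<rho> g - 1 / real (Suc n) \<le> l (\<lambda>x. - g x) - l (\<lambda>x. - Y x) + \<rho> Y"
      using l[of n] Y unfolding F_def by blast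
    then show "EQ X L c Q (\<lambda>x. - Y x) - \<rho> Y \<le> EQ X L c Q (\<lambda>x. - g x) - \<rho> g + e"
      using n Q(2) L1_uminus[OF g] L1_uminus[OF Y] by (simp add: EQform_def)
  qed
  \<comment> \<open>By \<open>opt\<close> the supremum in the penalty is attained at Y = g. It is
    therefore finite, and rearranging gives the claim.\<close>
  have "penalty X L c \<rho> Q = ereal (EQ X L c Q (\<lambda>x. - g x) - \<rho> g)"
    unfolding penalty_def
  proof (rule antisym)
    show "(SUP Y\<in>L1. ereal (EQ X L c Q (\<lambda>x. - Y x) - \<rho> Y)) \<le> ereal (EQ X L c Q (\<lambda>x. - g x) - \<rho> g)"
      using opt by (intro SUP_least) simp
    show "ereal (EQ X L c Q (\<lambda>x. - g x) - \<rho> g) \<le> (SUP Y\<in>L1. ereal (EQ X L c Q (\<lambda>x. - Y x) - \<rho> Y))"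
      by (rule SUP_upper[OF g])
  qed
  then show ?thesis
    using Q(1) by (intro bexI[of _ Q]) auto
qed

end

theorem theorem3p6:
  fixes X :: "'a topology" and L :: "('a \<Rightarrow> real) set" and c :: "('a \<Rightarrow> real) \<Rightarrow> real"
    and \<rho> :: "('a \<Rightarrow> real) \<Rightarrow> real" and \<Q> :: "'a measure set"
  assumes "topspace X = UNIV"
    and "metrizable_space X" and "separable_space X"
    and "admissible_lattice X L"
    and "capacity L c" and "prokhorov X L c"
    and "convex_risk_measure X L c \<rho>"
    and "\<Q> \<subseteq> dual_prob X L c"
    and "\<forall>g \<in> L1set X L c.
           ereal (\<rho> g) = (SUP Q \<in> \<Q>. ereal (EQ X L c Q (\<lambda>x. - g x)) - penalty X L c \<rho> Q)"
    and "compactin (weak_star X L c) (weak_star X L c closure_of (EQform X L c ` \<Q>))"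
  shows "(let Qbar = weak_star X L c closure_of (EQform X L c ` \<Q>);
              QbarM = {Q \<in> dual_prob X L c. EQform X L c Q \<in> Qbar}
          in compactin (weak_star X L c) Qbar \<and> metrizable_space (subtopology (weak_star X L c) Qbar)
           \<and> Qbar = EQform X L c ` QbarM
           \<and> compactin (weak_topology X) QbarM \<and> metrizable_space (subtopology (weak_topology X) QbarM)
           \<and> (\<forall>g \<in> L1set X L c. \<exists>Q \<in> QbarM.
                 ereal (\<rho> g) = ereal (EQ X L c Q (\<lambda>x. - g x)) - penalty X L c \<rho> Q))"
proof -
  interpret compact_scenarios X L c \<Q>
    using assms separable_metrizable_imp_second_countable by unfold_locales auto
  show ?thesis
    unfolding Let_def
    using assms(10) metrizable_Qbar Qbar_eq compact_QbarM metrizable_QbarM supremum_attained[OF assms(9)]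
    unfolding QbarM_def Qbar_def by blast
qed

end
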